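(* Let $W$ be a primitive $\omega$-Stone space, $P$ a PO system and $\mathscr{Y}$ a trim $P$-partition of $W$. Then $\mathrm{id}(\mathscr{Y})$ is a rank $\mathrm{id}(P)$-partition of $W$. Moreover: (a) $(\mathrm{id}(\mathscr{Y}))^{o}=\mathscr{Y}$; (b) $\mathrm{id}(\mathscr{Y})$ regularly extends $\mathscr{Y}$; (c) the elements of $\mathrm{id}(\mathscr{Y})$ are the orbits of $P$-homeomorphisms of $W$; (d) if $\mathscr{V}$ is a complete semi-trim $Q$-partition of $W$ such that $\mathscr{V}^{o}=\mathscr{Y}$ (so that $\widehat{Q}=P$), then $\mathrm{id}(\mathscr{Y})\prec_{\beta}\mathscr{V}$, where $J\beta=\sup_{Q}J$ for $J\in\mathrm{id}(P)$; (e) if $Q$ is a PO system, $\mathscr{V}$ a trim $Q$-partition of $W$ and $\alpha\colon Q\to P$ a surjective morphism such that $\mathscr{V}\prec_{\alpha}\mathscr{Y}$, then there is a map $\mathrm{id}(\alpha)\colon\mathrm{id}(Q)\to\mathrm{id}(P)$ such that $\mathrm{id}(\mathscr{V})\prec_{\mathrm{id}(\alpha)}\mathrm{id}(\mathscr{Y})$.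
   Context: Maps are written on the right. A PO system is a set $P$ with an antisymmetric transitive relation $<$ (possibly $p<p$ for some $p$); $p\leqslant q$ means $p<q$ or $p=q$; $p\lneqq q$ means $p\leqslant q$ and $p\neq q$; $P^{d}=\{p\in P: p\nless p\}$; $p_{\uparrow}=\{q\in P: q\geqslant p\}$, $p_{\downarrow}=\{q\in P:q\leqslant p\}$. Suprema are with respect to $\leqslant$, and strictly increasing is with respect to $\lneqq$. A morphism $\alpha\colon Q\to P$ is a map such that for each $q\in Q$, $\{r\in Q: r>q\}\alpha=\{p\in P: p>q\alpha\}$. An ideal of $P$ is a non-empty lower subset $J$ such that any $x,y\in J$ have a common upper bound in $J$; principal ideals are those of the form $p_\downarrow$. The ideal completion $\mathrm{id}(P)$ is the set of ideals of $P$ ordered by inclusion, made into a PO system with $\mathrm{id}(P)^d=\{p_\downarrow\mid p\in P^d\}$ (so $J<K$ iff $J\subsetneqq K$, or $J=K\notin\mathrm{id}(P)^d$); $P$ is identified with the set of principal ideals in $\mathrm{id}(P)$. An element of $P$ is separated if it is not the supremum of a strictly increasing sequence in $P$. A Stone space $W$ is a locally compact Hausdorff space with a base of compact open sets (the Stone space of a Boolean ring, possibly without $1$); it is an $\omega$-Stone space if $R=\mathrm{Co}(W)$, the Boolean ring of compact open subsets, is countable. For $A\in R$ let $(A)=\{C\in R: C\subseteq A\}$; $A$ is pseudo-indecomposable (PI) if for all $B\in R$ with $B\subseteq A$, $(B)\cong(A)$ or $(A-B)\cong(A)$. $W$ is primitive if every element of $R$ is the disjoint union of finitely many PI elements. $\mathscr{X}=\{X_p\mid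 p\in P\}^{*}$ denotes a family of pairwise disjoint non-empty subsets $X_p$ of $W$ together with the remaining set $W-X$ (possibly empty), where $X=\bigcup_p X_p$; it is complete if $X=W$. With $S'$ the set of limit points of $S$, it is a $P$-partition if $X_p'\cap X=\bigcup_{q<p}X_q$ for all $p\in P$. Its label function is $\tau\colon X\to P$, $\tau(w)=p$ for $w\in X_p$. For $Y\subseteq W$, $T_{\mathscr{X}}(Y)=\{p: Y\cap X_p\neq\emptyset\}$. A compact open $A$ is $p$-trim, written $t(A)=p$, if $T_{\mathscr{X}}(A)=p_{\uparrow}$ and, if $p\in P^d$, also $|A\cap X_p|=1$; $\mathrm{Trim}_p(\mathscr{X})$ is the set of $p$-trim sets; a set is trim if it is $p$-trim for some $p$; $\widehat{P}$ is the set of $p$ for which there is a $p$-trim set. For $w\in W$, $I_w=\{t(A)\mid A\text{ trim},\,w\in A\}$. A point $w$ is clean if $w\in X_p$ for some $p$ and $w$ has a $p$-trim neighbourhood. Conditions: (T1) every element of $W$ has a neighbourhood base of trim sets; (T2) for each $p\in\widehat P$, every element of $W$ with a neighbourhood base of $p$-trim sets lies in $X_p$; (T3) all points in $X$ are clean; (ST3) clean points are dense in $X_p$ for $p\in\widehat P$. A $P$-partition is trim if T1, T2, T3 hold, and semi-trim if T1, T2, ST3 hold. The clean interior of a semi-trim partition $\mathscr{X}$ is $\mathscr{X}^o=\{Z_q\mid q\in\widehat P\}^*$, where $Z_q$ is the set of clean points in $X_q$. A $P$-homeomorphism of $W$ (with respect to a $P$-partition $\mathscr{X}$) is a homeomorphism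 $\alpha\colon W\to W$ with $X_p\alpha=X_p$ for all $p\in P$. For a trim $P$-partition $\mathscr{Y}$ of an $\omega$-Stone space $W$ ($P$ is then countable), the ideal completion is the complete partition $\mathrm{id}(\mathscr{Y})=\{Y(J)\mid J\in\mathrm{id}(P)\}$, where $Y(J)=\{w\in W\mid I_w=J\}$ ($I_w$ computed in $\mathscr{Y}$). A complete $P$-partition is a rank $P$-partition if: (RP1) if $q$ is separated, $x=\lim x_k$, $\tau(x)\geqslant q$ and $\{\tau(x_k)\mid k\geqslant1\}$ are either pairwise strictly incomparable or strictly increasing, then $\tau(x_k)\geqslant q$ for all but finitely many $k$; (RP2) if $\tau(x)$ is not separated, then $x=\lim x_k$ for some $x_k$ with $\tau(x_k)\lneqq\tau(x)$ for all $k$. If $Q\subseteq P$ are PO systems, a $P$-partition $\mathscr{X}=\{X_p\}^*$ regularly extends (is a regular extension of) a semi-trim $Q$-partition $\mathscr{Y}=\{Y_q\}^*$ if $Y_q\subseteq X_q$ for each $q\in Q$, and for all $A\in\mathrm{Co}(W)$ and $p\in T_{\mathscr{X}}(A)$ there is $q\in T_{\mathscr{Y}}(A)$ with $q\leqslant p$. For a $P$-partition $\mathscr{Z}=\{Z_p\}^*$ and $Q$-partition $\mathscr{Y}=\{Y_q\}^*$ satisfying T1 and a map $\alpha\colon Q\to P$, $\mathscr{Y}\prec_\alpha\mathscr{Z}$ ($\mathscr{Y}$ regularly refines $\mathscr{Z}$ via $\alpha$) means $Y_q\subseteq Z_{q\alpha}$ for all $q\in Q$, and $p\in T_{\mathscr{Y}}(A)\alpha$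 for all $p\in\widehat P$ and $A\in\mathrm{Trim}_p(\mathscr{Z})$ (here the PO systems need not be countable). *)

theory Defs
  imports "HOL-Analysis.Analysis" "HOL-Algebra.QuotRing"
begin

record 'p po_system =
  elems :: "'p set"
  rel :: "('p \<times> 'p) set"

text \<open>\<open>(p, q) \<in> rel P\<close> is the relation \<open>p < q\<close>, which may hold for \<open>p = q\<close>. The carrier is
  a subset of a type, so that one PO system can be a subsystem of another.\<close>

definition po_system :: "'p po_system \<Rightarrow> bool" where
  "po_system P \<longleftrightarrow> rel P \<subseteq> elems P \<times> elems P \<and> antisym (rel P) \<and> trans (rel P)"

definition po_le :: "'p po_system \<Rightarrow> 'p \<Rightarrow> 'p \<Rightarrow> bool" where
  "po_le P p q \<longleftrightarrow> p \<in> elems P \<and> q \<in> elems P \<and> ((p, q) \<in> rel P \<or> p = q)"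

definition po_less :: "'p po_system \<Rightarrow> 'p \<Rightarrow> 'p \<Rightarrow> bool" where
  "po_less P p q \<longleftrightarrow> po_le P p q \<and> p \<noteq> q"

definition po_d :: "'p po_system \<Rightarrow> 'p set" where
  "po_d P = {p \<in> elems P. (p, p) \<notin> rel P}"

definition po_up :: "'p po_system \<Rightarrow> 'p \<Rightarrow> 'p set" where
  "po_up P p = {q. po_le P p q}"

definition po_down :: "'p po_system \<Rightarrow> 'p \<Rightarrow> 'p set" where
  "po_down P p = {q. po_le P q p}"

definition is_po_sup :: "'p po_system \<Rightarrow> 'p set \<Rightarrow> 'p \<Rightarrow> bool" where
  "is_po_sup P S p \<longleftrightarrow> p \<in> elems P \<and> (\<forall>s\<in>S. po_le P s p) \<and>
     (\<forall>u\<in>elems P. (\<forall>s\<in>S. po_le P s u) \<longrightarrow> po_le P p u)"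

definition po_strictly_increasing :: "'p po_system \<Rightarrow> (nat \<Rightarrow> 'p) \<Rightarrow> bool" where
  "po_strictly_increasing P s \<longleftrightarrow> (\<forall>i j. i < j \<longrightarrow> po_less P (s i) (s j))"

definition po_separated :: "'p po_system \<Rightarrow> 'p \<Rightarrow> bool" where
  "po_separated P p \<longleftrightarrow> p \<in> elems P \<and>
     \<not> (\<exists>s. po_strictly_increasing P s \<and> is_po_sup P (range s) p)"

definition po_morphism :: "'q po_system \<Rightarrow> 'p po_system \<Rightarrow> ('q \<Rightarrow> 'p) \<Rightarrow> bool" where
  "po_morphism Q P \<alpha> \<longleftrightarrow> \<alpha> \<in> elems Q \<rightarrow> elems P \<and>
     (\<forall>q\<in>elems Q. \<alpha> ` {r \<in> elems Q. (q, r) \<in> rel Q} = {p \<in> elems P. (\<alpha> q, p) \<in> rel P})"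

definition po_subsystem :: "'p po_system \<Rightarrow> 'p po_system \<Rightarrow> bool" where
  "po_subsystem Q P \<longleftrightarrow> elems Q \<subseteq> elems P \<and> rel Q = rel P \<inter> (elems Q \<times> elems Q)"

definition po_ideal :: "'p po_system \<Rightarrow> 'p set \<Rightarrow> bool" where
  "po_ideal P J \<longleftrightarrow> J \<noteq> {} \<and> J \<subseteq> elems P \<and>
     (\<forall>x\<in>J. \<forall>y. po_le P y x \<longrightarrow> y \<in> J) \<and>
     (\<forall>x\<in>J. \<forall>y\<in>J. \<exists>z\<in>J. po_le P x z \<and> po_le P y z)"

definition ideal_completion :: "'p po_system \<Rightarrow> 'p set po_system" where
  "ideal_completion P =
     \<lparr>elems = {J. po_ideal P J},
      rel = {(J, K). po_ideal P J \<and> po_ideal P K \<and>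
               (J \<subset> K \<or> J = K \<and> J \<notin> po_down P ` po_d P)}\<rparr>"

text \<open>\<open>principal_po P\<close> is \<open>P\<close> identified with its set of principal ideals, and
  \<open>as_principal P X\<close> is the family \<open>X\<close> reindexed accordingly, i.e. with \<open>X p\<close> at index
  \<open>po_down P p\<close>.\<close>

definition principal_po :: "'p po_system \<Rightarrow> 'p set po_system" where
  "principal_po P =
     \<lparr>elems = po_down P ` elems P,
      rel = {(po_down P p, po_down P q) | p q. (p, q) \<in> rel P}\<rparr>"

definition as_principal :: "'p po_system \<Rightarrow> ('p \<Rightarrow> 'w set) \<Rightarrow> 'p set \<Rightarrow> 'w set" where
  "as_principal P X J = X (inv_into (elems P) (po_down P) J)"

definition Co :: "'w topology \<Rightarrow> 'w set set" where
  "Co W = {A. compactin W A \<and> openin W A}"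

definition omega_Stone_space :: "'w topology \<Rightarrow> bool" where
  "omega_Stone_space W \<longleftrightarrow> locally_compact_space W \<and> Hausdorff_space W \<and>
     (\<forall>U w. openin W U \<and> w \<in> U \<longrightarrow> (\<exists>A\<in>Co W. w \<in> A \<and> A \<subseteq> U)) \<and>
     countable (Co W)"

text \<open>The ideal \<open>(A)\<close> is a Boolean ring with unit \<open>A\<close>; a bijection preserving addition and
  multiplication automatically preserves the unit, so unital ring isomorphism is the right
  notion.\<close>

definition Co_below :: "'w topology \<Rightarrow> 'w set \<Rightarrow> 'w set ring" where
  "Co_below W A =
     \<lparr>carrier = {C \<in> Co W. C \<subseteq> A}, monoid.mult = (\<inter>), one = A, zero = {},
      add = (\<lambda>C D. sym_diff C D)\<rparr>"

definition pseudo_indecomposable :: "'w topology \<Rightarrow> 'w set \<Rightarrow> bool" where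
  "pseudo_indecomposable W A \<longleftrightarrow> A \<in> Co W \<and>
     (\<forall>B\<in>Co W. B \<subseteq> A \<longrightarrow>
        Co_below W B \<simeq> Co_below W A \<or> Co_below W (A - B) \<simeq> Co_below W A)"

definition primitive_space :: "'w topology \<Rightarrow> bool" where
  "primitive_space W \<longleftrightarrow>
     (\<forall>A\<in>Co W. \<exists>F. finite F \<and> (\<forall>B\<in>F. pseudo_indecomposable W B) \<and>
        pairwise disjnt F \<and> \<Union>F = A)"

text \<open>A family \<open>{X\<^sub>p | p \<in> P}\<^sup>*\<close> is a function \<open>X\<close> of which only the values on \<open>elems P\<close> matter.\<close>

definition union_of_family :: "'p po_system \<Rightarrow> ('p \<Rightarrow> 'w set) \<Rightarrow> 'w set" where
  "union_of_family P X = (\<Union>p\<in>elems P. X p)"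

definition PO_partition :: "'w topology \<Rightarrow> 'p po_system \<Rightarrow> ('p \<Rightarrow> 'w set) \<Rightarrow> bool" where
  "PO_partition W P X \<longleftrightarrow> po_system P \<and>
     (\<forall>p\<in>elems P. X p \<noteq> {} \<and> X p \<subseteq> topspace W) \<and>
     disjoint_family_on X (elems P) \<and>
     (\<forall>p\<in>elems P. (W derived_set_of X p) \<inter> union_of_family P X =
        (\<Union>q\<in>{q \<in> elems P. (q, p) \<in> rel P}. X q))"

definition complete_partition :: "'w topology \<Rightarrow> 'p po_system \<Rightarrow> ('p \<Rightarrow> 'w set) \<Rightarrow> bool" where
  "complete_partition W P X \<longleftrightarrow> PO_partition W P X \<and> union_of_family P X = topspace W"

definition label :: "'p po_system \<Rightarrow> ('p \<Rightarrow> 'w set) \<Rightarrow> 'w \<Rightarrow> 'p" where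
  "label P X w = (THE p. p \<in> elems P \<and> w \<in> X p)"

definition type_set :: "'p po_system \<Rightarrow> ('p \<Rightarrow> 'w set) \<Rightarrow> 'w set \<Rightarrow> 'p set" where
  "type_set P X S = {p \<in> elems P. S \<inter> X p \<noteq> {}}"

definition Trim :: "'w topology \<Rightarrow> 'p po_system \<Rightarrow> ('p \<Rightarrow> 'w set) \<Rightarrow> 'p \<Rightarrow> 'w set set" where
  "Trim W P X p = {A \<in> Co W. p \<in> elems P \<and> type_set P X A = po_up P p \<and>
     (p \<in> po_d P \<longrightarrow> card (A \<inter> X p) = 1)}"

definition trim_labels :: "'w topology \<Rightarrow> 'p po_system \<Rightarrow> ('p \<Rightarrow> 'w set) \<Rightarrow> 'p set" where
  "trim_labels W P X = {p \<in> elems P. Trim W P X p \<noteq> {}}"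

definition point_ideal :: "'w topology \<Rightarrow> 'p po_system \<Rightarrow> ('p \<Rightarrow> 'w set) \<Rightarrow> 'w \<Rightarrow> 'p set" where
  "point_ideal W P X w = {p \<in> elems P. \<exists>A\<in>Trim W P X p. w \<in> A}"

definition clean :: "'w topology \<Rightarrow> 'p po_system \<Rightarrow> ('p \<Rightarrow> 'w set) \<Rightarrow> 'w \<Rightarrow> bool" where
  "clean W P X w \<longleftrightarrow> (\<exists>p\<in>elems P. w \<in> X p \<and> (\<exists>A\<in>Trim W P X p. w \<in> A))"

definition T1_cond :: "'w topology \<Rightarrow> 'p po_system \<Rightarrow> ('p \<Rightarrow> 'w set) \<Rightarrow> bool" where
  "T1_cond W P X \<longleftrightarrow> (\<forall>w\<in>topspace W. \<forall>U. openin W U \<and> w \<in> U \<longrightarrow>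
     (\<exists>p\<in>elems P. \<exists>A\<in>Trim W P X p. w \<in> A \<and> A \<subseteq> U))"

definition T2_cond :: "'w topology \<Rightarrow> 'p po_system \<Rightarrow> ('p \<Rightarrow> 'w set) \<Rightarrow> bool" where
  "T2_cond W P X \<longleftrightarrow> (\<forall>p\<in>trim_labels W P X. \<forall>w\<in>topspace W.
     (\<forall>U. openin W U \<and> w \<in> U \<longrightarrow> (\<exists>A\<in>Trim W P X p. w \<in> A \<and> A \<subseteq> U)) \<longrightarrow> w \<in> X p)"

definition T3_cond :: "'w topology \<Rightarrow> 'p po_system \<Rightarrow> ('p \<Rightarrow> 'w set) \<Rightarrow> bool" where
  "T3_cond W P X \<longleftrightarrow> (\<forall>w\<in>union_of_family P X. clean W P X w)"

definition clean_interior :: "'w topology \<Rightarrow> 'p po_system \<Rightarrow> ('p \<Rightarrow> 'w set) \<Rightarrow> 'p \<Rightarrow> 'w set" where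
  "clean_interior W P X p = {w \<in> X p. clean W P X w}"

definition ST3_cond :: "'w topology \<Rightarrow> 'p po_system \<Rightarrow> ('p \<Rightarrow> 'w set) \<Rightarrow> bool" where
  "ST3_cond W P X \<longleftrightarrow>
     (\<forall>p\<in>trim_labels W P X. X p \<subseteq> W closure_of (clean_interior W P X p))"

definition trim_partition :: "'w topology \<Rightarrow> 'p po_system \<Rightarrow> ('p \<Rightarrow> 'w set) \<Rightarrow> bool" where
  "trim_partition W P X \<longleftrightarrow>
     PO_partition W P X \<and> T1_cond W P X \<and> T2_cond W P X \<and> T3_cond W P X"

definition semi_trim_partition :: "'w topology \<Rightarrow> 'p po_system \<Rightarrow> ('p \<Rightarrow> 'w set) \<Rightarrow> bool" where
  "semi_trim_partition W P X \<longleftrightarrow>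
     PO_partition W P X \<and> T1_cond W P X \<and> T2_cond W P X \<and> ST3_cond W P X"

text \<open>\<open>clean_interior_eq W P X I Y\<close>: the clean interior of \<open>X\<close>, a family indexed by
  \<open>trim_labels W P X\<close>, is the family \<open>Y\<close> indexed by \<open>I\<close>. The clean interior is defined for
  semi-trim partitions only, so this is part of the condition.\<close>

definition clean_interior_eq ::
    "'w topology \<Rightarrow> 'p po_system \<Rightarrow> ('p \<Rightarrow> 'w set) \<Rightarrow> 'p set \<Rightarrow> ('p \<Rightarrow> 'w set) \<Rightarrow> bool" where
  "clean_interior_eq W P X I Y \<longleftrightarrow> semi_trim_partition W P X \<and>
     trim_labels W P X = I \<and> (\<forall>p\<in>I. clean_interior W P X p = Y p)"

definition id_partition ::
    "'w topology \<Rightarrow> 'p po_system \<Rightarrow> ('p \<Rightarrow> 'w set) \<Rightarrow> 'p set \<Rightarrow> 'w set" where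
  "id_partition W P Y J = {w \<in> topspace W. point_ideal W P Y w = J}"

definition PO_homeomorphism ::
    "'w topology \<Rightarrow> 'p po_system \<Rightarrow> ('p \<Rightarrow> 'w set) \<Rightarrow> ('w \<Rightarrow> 'w) \<Rightarrow> bool" where
  "PO_homeomorphism W P X \<alpha> \<longleftrightarrow> homeomorphic_map W W \<alpha> \<and> (\<forall>p\<in>elems P. \<alpha> ` X p = X p)"

definition PO_homeo_orbits ::
    "'w topology \<Rightarrow> 'p po_system \<Rightarrow> ('p \<Rightarrow> 'w set) \<Rightarrow> 'w set set" where
  "PO_homeo_orbits W P X = (\<lambda>w. {\<alpha> w | \<alpha>. PO_homeomorphism W P X \<alpha>}) ` topspace W"

text \<open>As strict increase does, strict incomparability refers to \<open>po_less\<close>: the labels \<open>\<tau>(x\<^sub>k)\<close>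
  may repeat, but distinct ones are incomparable.\<close>

definition rank_partition :: "'w topology \<Rightarrow> 'p po_system \<Rightarrow> ('p \<Rightarrow> 'w set) \<Rightarrow> bool" where
  "rank_partition W P X \<longleftrightarrow> complete_partition W P X \<and>
     (\<forall>q x xs. po_separated P q \<and> x \<in> topspace W \<and> range xs \<subseteq> topspace W \<and>
        limitin W xs x sequentially \<and> po_le P q (label P X x) \<and>
        ((\<forall>i j. \<not> po_less P (label P X (xs i)) (label P X (xs j))) \<or>
         po_strictly_increasing P (\<lambda>k. label P X (xs k))) \<longrightarrow>
        finite {k. \<not> po_le P q (label P X (xs k))}) \<and>
     (\<forall>x\<in>topspace W. \<not> po_separated P (label P X x) \<longrightarrow>
        (\<exists>xs. range xs \<subseteq> topspace W \<and> limitin W xs x sequentially \<and>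
           (\<forall>k. po_less P (label P X (xs k)) (label P X x))))"

definition regularly_extends ::
    "'w topology \<Rightarrow> 'p po_system \<Rightarrow> ('p \<Rightarrow> 'w set) \<Rightarrow> 'p po_system \<Rightarrow> ('p \<Rightarrow> 'w set) \<Rightarrow> bool" where
  "regularly_extends W P X Q Y \<longleftrightarrow>
     po_subsystem Q P \<and> PO_partition W P X \<and> semi_trim_partition W Q Y \<and>
     (\<forall>q\<in>elems Q. Y q \<subseteq> X q) \<and>
     (\<forall>A\<in>Co W. \<forall>p\<in>type_set P X A. \<exists>q\<in>type_set Q Y A. po_le P q p)"

definition regularly_refines ::
    "'w topology \<Rightarrow> 'q po_system \<Rightarrow> ('q \<Rightarrow> 'w set) \<Rightarrow> ('q \<Rightarrow> 'p) \<Rightarrow>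
     'p po_system \<Rightarrow> ('p \<Rightarrow> 'w set) \<Rightarrow> bool" where
  "regularly_refines W Q Y \<alpha> P Z \<longleftrightarrow>
     PO_partition W P Z \<and> T1_cond W P Z \<and> PO_partition W Q Y \<and> T1_cond W Q Y \<and>
     \<alpha> \<in> elems Q \<rightarrow> elems P \<and>
     (\<forall>q\<in>elems Q. Y q \<subseteq> Z (\<alpha> q)) \<and>
     (\<forall>p\<in>trim_labels W P Z. \<forall>A\<in>Trim W P Z p. p \<in> \<alpha> ` type_set Q Y A)"

end

theory Submission
  imports Defs
begin

text \<open>
  The ideal \<open>I\<^sub>w\<close> of a point \<open>w\<close> collects the labels of its trim neighbourhoods. T1 makes it an ideal, and
  T2 and T3 make it principal, generated by \<open>p\<close>, exactly when \<open>w\<close> lies in \<open>Y\<^sub>p\<close> (\<open>X_iff_point_ideal\<close>).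
  Conversely every ideal \<open>J\<close> occurs, and occurs inside every trim set with label in \<open>J\<close>: a sequence
  of nested trim sets whose labels are cofinal in \<open>J\<close> can be made to shrink to one point, and that
  point has ideal \<open>J\<close> (\<open>exists_point_of_ideal\<close>). Hence the points whose ideals contain \<open>p\<close> are those
  covered by the \<open>p\<close>-trim sets, \<open>w\<close> is a limit of points of ideal \<open>J\<close> just when \<open>I\<^sub>w < J\<close>, and the
  completion has the same trim sets as \<open>Y\<close>. This gives a complete semi-trim partition whose clean
  interior is \<open>Y\<close> and which extends \<open>Y\<close> regularly. It is a rank partition because the separated
  elements of the ideal completion are precisely the principal ideals
  (\<open>separated_ideal_iff_principal\<close>).

  For the orbits, points \<open>u\<close> and \<open>v\<close> with the same ideal have disjoint trim neighbourhoods of a common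
  label. Any division of one of these into trim pieces can be copied in the other, since every
  trim set with label \<open>p\<close> contains infinitely many points of each label above \<open>p\<close>, and the copies
  can be arranged so that \<open>u\<close> and \<open>v\<close> lie in corresponding pieces (\<open>matched_split\<close>). Vaught's back and
  forth argument turns this into a homeomorphism between the neighbourhoods that takes \<open>u\<close> to \<open>v\<close>
  and preserves ideals (\<open>back_and_forth\<close>), and exchanging the two neighbourhoods extends it to the
  space (\<open>homogeneous\<close>).

  The last two parts compare ideals. If \<open>Y\<close> is the clean interior of a complete partition \<open>V\<close>, then
  the two partitions have the same trim sets, and the \<open>V\<close>-label of \<open>w\<close> is the supremum of \<open>I\<^sub>w\<close>
  (\<open>label_V_is_sup\<close>). If a trim partition \<open>V\<close> refines \<open>Y\<close> along \<open>\<alpha>\<close>, then the \<open>Y\<close>-ideal of a point is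
  generated by the \<open>\<alpha>\<close>-image of its \<open>V\<close>-ideal (\<open>point_ideal_of_refinement\<close>).
\<close>

section \<open>PO systems and their ideals\<close>

lemma po_le_refl: "p \<in> elems P \<Longrightarrow> po_le P p p"
  by (simp add: po_le_def)

lemma po_le_trans: "po_system P \<Longrightarrow> po_le P p q \<Longrightarrow> po_le P q r \<Longrightarrow> po_le P p r"
  unfolding po_le_def po_system_def by (metis transE)

lemma po_le_antisym: "po_system P \<Longrightarrow> po_le P p q \<Longrightarrow> po_le P q p \<Longrightarrow> p = q"
  unfolding po_le_def po_system_def by (metis antisymD)

lemma po_le_elems: "po_le P p q \<Longrightarrow> p \<in> elems P \<and> q \<in> elems P"
  by (simp add: po_le_def)

lemma rel_elems: "po_system P \<Longrightarrow> (p, q) \<in> rel P \<Longrightarrow> p \<in> elems P \<and> q \<in> elems P"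
  by (auto simp: po_system_def)

lemma mem_po_up: "q \<in> po_up P p \<longleftrightarrow> po_le P p q"
  by (simp add: po_up_def)

lemma mem_po_down: "q \<in> po_down P p \<longleftrightarrow> po_le P q p"
  by (simp add: po_down_def)

lemma po_down_self: "p \<in> elems P \<Longrightarrow> p \<in> po_down P p"
  by (simp add: mem_po_down po_le_refl)

lemma po_down_subset_iff:
  assumes "po_system P" "p \<in> elems P"
  shows "po_down P p \<subseteq> po_down P q \<longleftrightarrow> po_le P p q"
  using assms po_down_self[OF assms(2)] by (auto simp: mem_po_down intro: po_le_trans)

lemma po_down_eq_iff:
  assumes "po_system P" "p \<in> elems P" "q \<in> elems P"
  shows "po_down P p = po_down P q \<longleftrightarrow> p = q"
  by (metis assms mem_po_down po_le_antisym po_le_refl)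

lemma inj_on_po_down: "po_system P \<Longrightarrow> inj_on (po_down P) (elems P)"
  by (auto simp: inj_on_def po_down_eq_iff)

lemma po_ideal_down:
  assumes "po_system P" "p \<in> elems P"
  shows "po_ideal P (po_down P p)"
  unfolding po_ideal_def
proof (intro conjI ballI allI impI)
  show "po_down P p \<noteq> {}" using po_down_self[OF assms(2)] by blast
  show "po_down P p \<subseteq> elems P" by (auto simp: mem_po_down po_le_def)
next
  fix x y assume "x \<in> po_down P p" "po_le P y x"
  then show "y \<in> po_down P p" using assms by (auto simp: mem_po_down intro: po_le_trans)
next
  fix x y assume "x \<in> po_down P p" "y \<in> po_down P p"
  then show "\<exists>z\<in>po_down P p. po_le P x z \<and> po_le P y z"
    using po_down_self[OF assms(2)] by (metis mem_po_down)
qed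

lemma po_ideal_lower: "po_ideal P J \<Longrightarrow> p \<in> J \<Longrightarrow> po_le P q p \<Longrightarrow> q \<in> J"
  by (auto simp: po_ideal_def)

lemma po_ideal_elems: "po_ideal P J \<Longrightarrow> p \<in> J \<Longrightarrow> p \<in> elems P"
  by (auto simp: po_ideal_def)

lemma po_ideal_directed:
  "po_ideal P J \<Longrightarrow> p \<in> J \<Longrightarrow> q \<in> J \<Longrightarrow> \<exists>r\<in>J. po_le P p r \<and> po_le P q r"
  by (auto simp: po_ideal_def)

lemma po_down_subset_ideal:
  assumes "po_system P" "po_ideal P J" "p \<in> elems P"
  shows "po_down P p \<subseteq> J \<longleftrightarrow> p \<in> J"
  using po_down_self[OF assms(3)] po_ideal_lower[OF assms(2)] by (auto simp: mem_po_down)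

text \<open>A countable ideal is exhausted by an increasing sequence, which may start anywhere in the
  ideal: bound an enumeration of the ideal from above, one element at a time.\<close>

lemma po_ideal_cofinal_sequence:
  assumes P: "po_system P" and J: "po_ideal P J" and cnt: "countable J" and r: "r \<in> J"
  obtains s where "s 0 = r" "\<And>n. s n \<in> J" "\<And>n. po_le P (s n) (s (Suc n))"
    "\<And>p. p \<in> J \<Longrightarrow> \<exists>n. po_le P p (s n)"
proof -
  define e where "e = from_nat_into J"
  have e: "e n \<in> J" for n using r by (metis e_def empty_iff from_nat_into)
  obtain b where b: "\<And>p q. p \<in> J \<Longrightarrow> q \<in> J \<Longrightarrow> b p q \<in> J \<and> po_le P p (b p q) \<and> po_le P q (b p q)"
    using po_ideal_directed[OF J] by metis
  define s where "s = rec_nat r (\<lambda>n x. b x (e n))"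
  have s0: "s 0 = r" and sS: "s (Suc n) = b (s n) (e n)" for n by (simp_all add: s_def)
  have sJ: "s n \<in> J" for n by (induction n) (use r b e in \<open>auto simp: s0 sS\<close>)
  show ?thesis
  proof (rule that[of s])
    fix p assume "p \<in> J"
    then obtain n where "e n = p" using cnt by (metis e_def from_nat_into_to_nat_on)
    then show "\<exists>n. po_le P p (s n)" using b[OF sJ e] sS by metis
  qed (use s0 sJ b[OF sJ e] sS in auto)
qed

lemma po_system_ideal_completion: "po_system (ideal_completion P)"
  unfolding po_system_def ideal_completion_def
  by (auto simp: antisym_def trans_def)

lemma elems_ideal_completion [simp]: "J \<in> elems (ideal_completion P) \<longleftrightarrow> po_ideal P J"
  by (simp add: ideal_completion_def)

lemma po_le_ideal_completion:
  "po_le (ideal_completion P) J K \<longleftrightarrow> po_ideal P J \<and> po_ideal P K \<and> J \<subseteq> K"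
  by (auto simp: po_le_def ideal_completion_def)

lemma po_less_ideal_completion:
  "po_less (ideal_completion P) J K \<longleftrightarrow> po_ideal P J \<and> po_ideal P K \<and> J \<subset> K"
  by (auto simp: po_less_def po_le_ideal_completion)

lemma po_d_ideal_completion:
  assumes "po_system P"
  shows "po_d (ideal_completion P) = po_down P ` po_d P"
  using po_ideal_down[OF assms] by (auto simp: po_d_def ideal_completion_def)

lemma po_subsystem_principal:
  assumes P: "po_system P"
  shows "po_subsystem (principal_po P) (ideal_completion P)"
proof -
  have "(po_down P p, po_down P q) \<in> rel (ideal_completion P) \<longleftrightarrow> (p, q) \<in> rel P"
    if pq: "p \<in> elems P" "q \<in> elems P" for p q
  proof -
    have "(po_down P p, po_down P q) \<in> rel (ideal_completion P) \<longleftrightarrow>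
        po_le P p q \<and> (p \<noteq> q \<or> p \<notin> po_d P)"
      using pq po_ideal_down[OF P] po_down_subset_iff[OF P] po_down_eq_iff[OF P]
      by (auto simp: ideal_completion_def psubset_eq po_d_def po_le_refl)
    also have "\<dots> \<longleftrightarrow> (p, q) \<in> rel P"
      using pq by (auto simp: po_le_def po_d_def)
    finally show ?thesis .
  qed
  then have "rel (principal_po P) =
      rel (ideal_completion P) \<inter> (elems (principal_po P) \<times> elems (principal_po P))"
    using rel_elems[OF P] by (fastforce simp: principal_po_def)
  moreover have "elems (principal_po P) \<subseteq> elems (ideal_completion P)"
    using po_ideal_down[OF P] by (auto simp: principal_po_def)
  ultimately show ?thesis by (simp add: po_subsystem_def)
qed

text \<open>An increasing union of ideals is an ideal, hence is the supremum in the ideal completion.\<close>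

lemma ideal_sup_of_increasing:
  assumes P: "po_system P" and inc: "po_strictly_increasing (ideal_completion P) S"
  shows "is_po_sup (ideal_completion P) (range S) (\<Union>(range S))"
proof -
  have S: "po_ideal P (S n)" for n
    using inc by (auto simp: po_strictly_increasing_def po_less_ideal_completion)
  have mono: "S i \<subseteq> S j" if "i \<le> j" for i j
  proof (cases "i = j")
    case False
    then have "i < j" using that by simp
    then show ?thesis
      using inc by (simp add: po_strictly_increasing_def po_less_ideal_completion psubset_eq)
  qed simp
  have "po_ideal P (\<Union>(range S))"
    unfolding po_ideal_def
  proof (intro conjI ballI allI impI)
    show "\<Union>(range S) \<noteq> {}" using S by (auto simp: po_ideal_def)
    show "\<Union>(range S) \<subseteq> elems P" using po_ideal_elems[OF S] by blast
  next
    fix x y assume "x \<in> \<Union>(range S)" "po_le P y x"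
    then show "y \<in> \<Union>(range S)" using po_ideal_lower[OF S] by blast
  next
    fix x y assume "x \<in> \<Union>(range S)" "y \<in> \<Union>(range S)"
    then obtain i j where "x \<in> S i" "y \<in> S j" by blast
    then have "x \<in> S (max i j)" "y \<in> S (max i j)" using mono[of i "max i j"] mono[of j "max i j"] by auto
    then show "\<exists>z\<in>\<Union>(range S). po_le P x z \<and> po_le P y z"
      using po_ideal_directed[OF S] by blast
  qed
  then show ?thesis using S by (auto simp: is_po_sup_def po_le_ideal_completion)
qed

lemma is_po_sup_unique:
  "po_system P \<Longrightarrow> is_po_sup P S p \<Longrightarrow> is_po_sup P S q \<Longrightarrow> p = q"
  unfolding is_po_sup_def by (metis po_le_antisym)

text \<open>A principal ideal that is an increasing union is already one of the members of the union; a
  non-principal countable ideal is the union of the principal ideals along a strictly increasing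
  cofinal sequence.\<close>

lemma separated_ideal_iff_principal:
  assumes P: "po_system P" and J: "po_ideal P J" and cnt: "countable (elems P)"
  shows "po_separated (ideal_completion P) J \<longleftrightarrow> J \<in> po_down P ` elems P"
proof
  assume "J \<in> po_down P ` elems P"
  then obtain p where p: "p \<in> elems P" and Jp: "J = po_down P p" by blast
  have False if inc: "po_strictly_increasing (ideal_completion P) S"
    and sup: "is_po_sup (ideal_completion P) (range S) J" for S
  proof -
    have "J = \<Union>(range S)"
      using is_po_sup_unique[OF po_system_ideal_completion sup ideal_sup_of_increasing[OF P inc]] .
    moreover have "p \<in> J" using Jp p by (simp add: mem_po_down po_le_refl)
    ultimately obtain n where "p \<in> S n" by blast
    have "po_ideal P (S n)" "S n \<subset> S (Suc n)"
      using inc by (auto simp: po_strictly_increasing_def po_less_ideal_completion)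
    then have "J \<subseteq> S n" using po_down_subset_ideal[OF P _ p] Jp \<open>p \<in> S n\<close> by blast
    then show False using \<open>S n \<subset> S (Suc n)\<close> \<open>J = \<Union>(range S)\<close> by blast
  qed
  then show "po_separated (ideal_completion P) J" using J by (auto simp: po_separated_def)
next
  assume sep: "po_separated (ideal_completion P) J"
  show "J \<in> po_down P ` elems P"
  proof (rule ccontr)
    assume np: "J \<notin> po_down P ` elems P"
    have up: "\<exists>q\<in>J. po_less P p q" if "p \<in> J" for p
    proof (rule ccontr)
      assume *: "\<not> ?thesis"
      have "J \<subseteq> po_down P p"
      proof
        fix q assume "q \<in> J"
        then obtain r where "r \<in> J" "po_le P p r" "po_le P q r"
          using po_ideal_directed[OF J \<open>p \<in> J\<close>] by blast
        then show "q \<in> po_down P p" using * by (auto simp: po_less_def mem_po_down)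
      qed
      moreover have "po_down P p \<subseteq> J"
        using that po_down_subset_ideal[OF P J po_ideal_elems[OF J that]] by blast
      ultimately show False using np that po_ideal_elems[OF J that] by blast
    qed
    have cJ: "countable J" using cnt J by (meson countable_subset po_ideal_def)
    define e where "e = from_nat_into J"
    have ne: "J \<noteq> {}" using J by (auto simp: po_ideal_def)
    have e: "e n \<in> J" for n using ne by (simp add: e_def from_nat_into)
    have "\<exists>r\<in>J. po_less P p r \<and> po_le P q r" if "p \<in> J" "q \<in> J" for p q
    proof -
      obtain p' where p': "p' \<in> J" "po_less P p p'" using up[OF \<open>p \<in> J\<close>] by blast
      then obtain r where r: "r \<in> J" "po_le P p' r" "po_le P q r"
        using po_ideal_directed[OF J _ \<open>q \<in> J\<close>] by blast
      then have "po_less P p r" using p' P unfolding po_less_def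
        by (metis po_le_antisym po_le_trans)
      then show ?thesis using r by blast
    qed
    then obtain b where b: "\<And>p q. p \<in> J \<Longrightarrow> q \<in> J \<Longrightarrow> b p q \<in> J \<and> po_less P p (b p q) \<and> po_le P q (b p q)"
      by metis
    define s where "s = rec_nat (e 0) (\<lambda>n x. b x (e n))"
    have s0: "s 0 = e 0" and sS: "s (Suc n) = b (s n) (e n)" for n by (simp_all add: s_def)
    have sJ: "s n \<in> J" for n by (induction n) (use b e in \<open>auto simp: s0 sS\<close>)
    have step: "po_down P (s n) \<subset> po_down P (s (Suc n))" for n
    proof -
      have "po_less P (s n) (s (Suc n))" using b[OF sJ e] sS by simp
      then show ?thesis
        using po_down_subset_iff[OF P] po_down_eq_iff[OF P]
        by (metis po_less_def po_le_elems psubset_eq)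
    qed
    have strict: "po_down P (s i) \<subset> po_down P (s j)" if "i < j" for i j
      using that by (rule lift_Suc_mono_less[of "\<lambda>n. po_down P (s n)", OF step])
    have inc: "po_strictly_increasing (ideal_completion P) (\<lambda>n. po_down P (s n))"
      using strict po_ideal_down[OF P] po_ideal_elems[OF J sJ]
      by (auto simp: po_strictly_increasing_def po_less_ideal_completion)
    have "(\<Union>n. po_down P (s n)) = J"
    proof
      show "(\<Union>n. po_down P (s n)) \<subseteq> J"
        using po_down_subset_ideal[OF P J po_ideal_elems[OF J sJ]] sJ by blast
      show "J \<subseteq> (\<Union>n. po_down P (s n))"
      proof
        fix p assume "p \<in> J"
        then obtain n where "e n = p" using cJ by (metis e_def from_nat_into_to_nat_on)
        then have "po_le P p (s (Suc n))" using b[OF sJ e] sS by metis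
        then show "p \<in> (\<Union>n. po_down P (s n))" by (auto simp: mem_po_down)
      qed
    qed
    then show False
      using sep ideal_sup_of_increasing[OF P inc] inc by (auto simp: po_separated_def)
  qed
qed

section \<open>Compact open sets\<close>

lemma Co_compactin: "A \<in> Co W \<Longrightarrow> compactin W A"
  and Co_openin: "A \<in> Co W \<Longrightarrow> openin W A"
  and Co_subset_topspace: "A \<in> Co W \<Longrightarrow> A \<subseteq> topspace W"
  by (auto simp: Co_def dest: openin_subset)

lemma empty_in_Co: "{} \<in> Co W"
  by (simp add: Co_def)

lemma Co_Un: "A \<in> Co W \<Longrightarrow> B \<in> Co W \<Longrightarrow> A \<union> B \<in> Co W"
  by (simp add: Co_def compactin_Un openin_Un)

locale omega_stone =
  fixes W :: "'w topology"
  assumes omega_stone: "omega_Stone_space W"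
begin

lemma hausdorff: "Hausdorff_space W"
  and countable_Co: "countable (Co W)"
  using omega_stone by (auto simp: omega_Stone_space_def)

lemma Co_base: "openin W U \<Longrightarrow> w \<in> U \<Longrightarrow> \<exists>A\<in>Co W. w \<in> A \<and> A \<subseteq> U"
  using omega_stone by (auto simp: omega_Stone_space_def)

lemma Co_closedin: "A \<in> Co W \<Longrightarrow> closedin W A"
  by (simp add: Co_compactin compactin_imp_closedin hausdorff)

lemma Co_Diff:
  assumes "A \<in> Co W" "B \<in> Co W"
  shows "A - B \<in> Co W"
proof -
  have "openin W (A - B)" using assms by (simp add: Co_closedin Co_openin openin_diff)
  moreover have "compactin W (A \<inter> (topspace W - B))"
    using assms by (intro compact_Int_closedin) (auto simp: Co_compactin Co_openin)
  moreover have "A \<inter> (topspace W - B) = A - B" using Co_subset_topspace[OF assms(1)] by blast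
  ultimately show ?thesis by (simp add: Co_def)
qed

lemma Co_Int:
  assumes "A \<in> Co W" "B \<in> Co W"
  shows "A \<inter> B \<in> Co W"
  using Co_Diff[OF assms(1) Co_Diff[OF assms]] by (simp add: Diff_Diff_Int)

lemma openin_minus_finite:
  assumes "openin W U" "finite F"
  shows "openin W (U - F)"
proof -
  have "closedin W (F \<inter> topspace W)"
    using assms Hausdorff_imp_t1_space[OF hausdorff] by (simp add: t1_space_closedin_finite)
  then have "openin W (U - F \<inter> topspace W)" using assms by (simp add: openin_diff)
  then show ?thesis using openin_subset[OF assms(1)] by (metis Diff_Int2 Int_Diff inf.absorb1)
qed

definition Co_enum :: "nat \<Rightarrow> 'w set" where
  "Co_enum = from_nat_into (Co W)"

lemma Co_enum_in: "Co_enum n \<in> Co W"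
  by (metis Co_enum_def empty_iff empty_in_Co from_nat_into)

lemma Co_enum_surj: "A \<in> Co W \<Longrightarrow> \<exists>n. Co_enum n = A"
  by (metis Co_enum_def countable_Co from_nat_into_to_nat_on)

lemma nested_Co_nonempty:
  assumes "\<And>n. A n \<in> Co W" "\<And>n. A n \<noteq> {}" "\<And>n. A (Suc n) \<subseteq> A n"
  shows "(\<Inter>n. A n) \<noteq> {}"
proof -
  let ?S = "subtopology W (A 0)"
  have dec: "A n \<subseteq> A m" if "m \<le> n" for m n
    using lift_Suc_antimono_le[of A, OF assms(3) that] .
  have "compact_space ?S" using assms by (simp add: Co_compactin compact_space_subtopology)
  moreover have "closedin ?S (A n)" for n
    using assms dec[of 0 n] by (simp add: Co_closedin closedin_subset_topspace)
  ultimately show ?thesis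
    using compact_space_imp_nest[of ?S A] assms dec by (simp add: decseq_def)
qed

lemma countable_nested_base:
  assumes "w \<in> topspace W"
  shows "\<exists>N :: nat \<Rightarrow> 'w set. (\<forall>n. N n \<in> Co W \<and> w \<in> N n) \<and>
      (\<forall>U. openin W U \<and> w \<in> U \<longrightarrow> (\<exists>n. \<forall>m\<ge>n. N m \<subseteq> U))"
proof -
  obtain A where A: "A \<in> Co W" "w \<in> A" using Co_base[OF openin_topspace assms] by blast
  (* Sets of the enumeration that miss w are replaced by A, so that the intersections keep w. *)
  define E where "E n = (if w \<in> Co_enum n then Co_enum n else A)" for n
  define N where "N = rec_nat A (\<lambda>n B. B \<inter> E n)"
  have N0: "N 0 = A" and NS: "N (Suc n) = N n \<inter> E n" for n by (simp_all add: N_def)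
  have N: "N n \<in> Co W \<and> w \<in> N n" for n
    by (induction n) (use A in \<open>auto simp: N0 NS E_def Co_enum_in Co_Int\<close>)
  show ?thesis
  proof (intro exI[of _ N] conjI allI impI)
    fix U assume "openin W U \<and> w \<in> U"
    then obtain B where B: "B \<in> Co W" "w \<in> B" "B \<subseteq> U" using Co_base by blast
    then obtain n where "Co_enum n = B" using Co_enum_surj by blast
    then have "N (Suc n) \<subseteq> B" using B by (auto simp: NS E_def)
    moreover have "N m \<subseteq> N (Suc n)" if "m \<ge> Suc n" for m
      using lift_Suc_antimono_le[of N, OF _ that] NS by blast
    ultimately show "\<exists>n. \<forall>m\<ge>n. N m \<subseteq> U" using B by blast
  qed (use N in auto)
qed

end

section \<open>PO partitions and their trim sets\<close>

locale stone_partition = omega_stone W for W :: "'w topology" +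
  fixes P :: "'p po_system" and X :: "'p \<Rightarrow> 'w set"
  assumes partition: "PO_partition W P X"
begin

lemma po: "po_system P"
  and X_nonempty: "p \<in> elems P \<Longrightarrow> X p \<noteq> {}"
  and X_topspace: "p \<in> elems P \<Longrightarrow> X p \<subseteq> topspace W"
  using partition by (auto simp: PO_partition_def)

lemma X_unique:
  "p \<in> elems P \<Longrightarrow> q \<in> elems P \<Longrightarrow> w \<in> X p \<Longrightarrow> w \<in> X q \<Longrightarrow> p = q"
  using partition unfolding PO_partition_def disjoint_family_on_def by blast

lemma derived_iff:
  assumes "p \<in> elems P" "q \<in> elems P" "w \<in> X q"
  shows "w \<in> W derived_set_of X p \<longleftrightarrow> (q, p) \<in> rel P"
proof -
  have "w \<in> union_of_family P X" using assms by (auto simp: union_of_family_def)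
  moreover have "W derived_set_of X p \<inter> union_of_family P X = (\<Union>q\<in>{q \<in> elems P. (q, p) \<in> rel P}. X q)"
    using partition assms(1) by (simp add: PO_partition_def)
  ultimately have "w \<in> W derived_set_of X p \<longleftrightarrow> w \<in> (\<Union>q\<in>{q \<in> elems P. (q, p) \<in> rel P}. X q)"
    by blast
  also have "\<dots> \<longleftrightarrow> (q, p) \<in> rel P" using assms X_unique by blast
  finally show ?thesis .
qed

lemma mem_type_set: "p \<in> type_set P X A \<longleftrightarrow> p \<in> elems P \<and> (\<exists>x. x \<in> A \<and> x \<in> X p)"
  by (auto simp: type_set_def)

text \<open>A point of \<open>X\<^sub>p\<close> is a limit point of \<open>X\<^sub>q\<close> when \<open>p < q\<close>, so an open set that meets
  \<open>X\<^sub>p\<close> meets \<open>X\<^sub>q\<close> infinitely often.\<close>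

lemma meets_above_outside_finite:
  assumes "openin W A" "p \<in> type_set P X A" "(p, q) \<in> rel P" "finite F"
  shows "\<exists>z\<in>A \<inter> X q. z \<notin> F"
proof -
  obtain w where w: "w \<in> A" "w \<in> X p" and p: "p \<in> elems P" using assms mem_type_set by auto
  have q: "q \<in> elems P" using assms(3) rel_elems[OF po] by blast
  have "w \<in> W derived_set_of X q" using derived_iff[OF q p w(2)] assms(3) by simp
  moreover have "openin W (A - (F - {w}))" using assms by (simp add: openin_minus_finite)
  moreover have "w \<in> A - (F - {w})" using w by blast
  ultimately have "\<exists>y. y \<noteq> w \<and> y \<in> X q \<and> y \<in> A - (F - {w})"
    unfolding in_derived_set_of by metis
  then show ?thesis by blast
qed

lemma type_set_upper:
  assumes "openin W A" "p \<in> type_set P X A" "po_le P p q"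
  shows "q \<in> type_set P X A"
proof (cases "p = q")
  case False
  then have "(p, q) \<in> rel P" using assms(3) by (simp add: po_le_def)
  then show ?thesis
    using meets_above_outside_finite[OF assms(1,2), of q "{}"] rel_elems[OF po]
    by (auto simp: mem_type_set)
qed (use assms in simp)

lemma type_set_Un: "type_set P X (A \<union> B) = type_set P X A \<union> type_set P X B"
  by (auto simp: mem_type_set)

lemma type_set_mono: "A \<subseteq> B \<Longrightarrow> type_set P X A \<subseteq> type_set P X B"
  by (fastforce simp: mem_type_set)

lemma Trim_Co: "A \<in> Trim W P X p \<Longrightarrow> A \<in> Co W"
  and Trim_elems: "A \<in> Trim W P X p \<Longrightarrow> p \<in> elems P"
  and Trim_card: "A \<in> Trim W P X p \<Longrightarrow> p \<in> po_d P \<Longrightarrow> card (A \<inter> X p) = 1"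
  by (auto simp: Trim_def)

lemma Trim_openin: "A \<in> Trim W P X p \<Longrightarrow> openin W A"
  by (simp add: Trim_Co Co_openin)

lemma Trim_type: "A \<in> Trim W P X p \<Longrightarrow> q \<in> type_set P X A \<longleftrightarrow> po_le P p q"
  by (auto simp: Trim_def mem_po_up)

lemma Trim_meets: "A \<in> Trim W P X p \<Longrightarrow> p \<in> type_set P X A"
  by (simp add: Trim_type Trim_elems po_le_refl)

lemma Trim_nonempty: "A \<in> Trim W P X p \<Longrightarrow> A \<noteq> {}"
  using Trim_meets by (auto simp: mem_type_set)

lemma TrimI:
  assumes "A \<in> Co W" "p \<in> type_set P X A" "\<And>q. q \<in> type_set P X A \<Longrightarrow> po_le P p q"
    and "p \<in> po_d P \<Longrightarrow> card (A \<inter> X p) = 1"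
  shows "A \<in> Trim W P X p"
proof -
  have "type_set P X A = po_up P p"
    using assms(3) type_set_upper[OF Co_openin[OF assms(1)] assms(2)] unfolding po_up_def by blast
  moreover have "p \<in> elems P" using assms(2) by (simp add: mem_type_set)
  ultimately show ?thesis using assms(1,4) by (simp add: Trim_def)
qed

lemma Trim_type_mono:
  "A \<in> Trim W P X p \<Longrightarrow> B \<in> Trim W P X q \<Longrightarrow> B \<subseteq> A \<Longrightarrow> po_le P p q"
  by (metis Trim_meets Trim_type subsetD type_set_mono)

text \<open>A compact open part of a \<open>p\<close>-trim set is \<open>p\<close>-trim as soon as it meets \<open>X\<^sub>p\<close>.\<close>

lemma Trim_subset:
  assumes A: "A \<in> Trim W P X p" and B: "B \<in> Co W" "B \<subseteq> A" "p \<in> type_set P X B"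
  shows "B \<in> Trim W P X p"
proof (rule TrimI)
  show "B \<in> Co W" "p \<in> type_set P X B" by fact+
  show "po_le P p q" if "q \<in> type_set P X B" for q
    using that type_set_mono[OF B(2)] Trim_type[OF A] by blast
  assume "p \<in> po_d P"
  then obtain x where "A \<inter> X p = {x}" using Trim_card[OF A] card_1_singletonE by metis
  moreover have "B \<inter> X p \<noteq> {}" using B by (auto simp: mem_type_set)
  moreover have "B \<inter> X p \<subseteq> A \<inter> X p" using B by blast
  ultimately have "B \<inter> X p = {x}" by (simp add: subset_singleton_iff)
  then show "card (B \<inter> X p) = 1" by simp
qed

text \<open>Adding points whose labels are above \<open>p\<close>, without a new point of \<open>X\<^sub>p\<close>, keeps a set
  \<open>p\<close>-trim.\<close>

lemma Trim_Un:
  assumes A: "A \<in> Trim W P X p" and B: "B \<in> Co W"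
    and up: "\<And>q. q \<in> type_set P X B \<Longrightarrow> po_le P p q" and new: "B \<inter> X p \<subseteq> A"
  shows "A \<union> B \<in> Trim W P X p"
proof (rule TrimI)
  show "A \<union> B \<in> Co W" using Trim_Co[OF A] B by (rule Co_Un)
  show "p \<in> type_set P X (A \<union> B)" using Trim_meets[OF A] by (simp add: type_set_Un)
  show "po_le P p q" if "q \<in> type_set P X (A \<union> B)" for q
    using that up Trim_type[OF A] by (auto simp: type_set_Un)
  have "(A \<union> B) \<inter> X p = A \<inter> X p" using new by blast
  then show "p \<in> po_d P \<Longrightarrow> card ((A \<union> B) \<inter> X p) = 1" using Trim_card[OF A] by simp
qed

lemma mem_point_ideal: "p \<in> point_ideal W P X w \<longleftrightarrow> (\<exists>A\<in>Trim W P X p. w \<in> A)"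
  using Trim_elems by (auto simp: point_ideal_def)

end

locale stone_T1_partition = stone_partition W P X for W :: "'w topology" and P :: "'p po_system" and X +
  assumes T1: "T1_cond W P X"
begin

lemma T1_base:
  assumes "openin W U" "w \<in> U"
  shows "\<exists>p\<in>point_ideal W P X w. \<exists>A\<in>Trim W P X p. w \<in> A \<and> A \<subseteq> U"
  using T1 assms openin_subset[OF assms(1)] unfolding T1_cond_def mem_point_ideal
  by (meson mem_point_ideal subsetD)

text \<open>A new trim set \<open>C\<close> with label \<open>q\<close> either brings a new point of \<open>X\<^sub>q\<close>, and then its new part is
  itself \<open>q\<close>-trim, or one of the old pieces meets \<open>X\<^sub>q\<close> and absorbs the new part.\<close>

lemma trim_union_disjoint_piece:
  assumes F: "finite F" "disjoint F" "\<And>B. B \<in> F \<Longrightarrow> \<exists>p. B \<in> Trim W P X p" and C: "C \<in> Trim W P X q"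
  shows "\<exists>G. finite G \<and> disjoint G \<and> (\<forall>B\<in>G. \<exists>p. B \<in> Trim W P X p) \<and> \<Union>G = \<Union>F \<union> C"
proof -
  have UF: "\<Union>F \<in> Co W"
    using F(1,3)
  proof (induction F rule: finite_induct)
    case (insert B F)
    then have "B \<in> Co W" "\<Union>F \<in> Co W" using Trim_Co by (blast, auto)
    then show ?case by (simp add: Co_Un)
  qed (simp add: empty_in_Co)
  let ?D = "C - \<Union>F"
  have D: "?D \<in> Co W" using Trim_Co[OF C] UF by (rule Co_Diff)
  show ?thesis
  proof (cases "q \<in> type_set P X ?D")
    case True
    then have "?D \<in> Trim W P X q" using Trim_subset[OF C D] by blast
    moreover have "disjoint (insert ?D F)" using F(2) by (auto simp: pairwise_insert disjnt_def)
    ultimately show ?thesis using F by (intro exI[of _ "insert ?D F"]) auto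
  next
    case False
    obtain y where y: "y \<in> C" "y \<in> X q" and q: "q \<in> elems P"
      using Trim_meets[OF C] by (auto simp: mem_type_set)
    then have "y \<in> \<Union>F" using False by (auto simp: mem_type_set)
    then obtain B p where B: "B \<in> F" "y \<in> B" "B \<in> Trim W P X p" using F(3) by blast
    then have pq: "po_le P p q" using y q Trim_type[OF B(3)] by (auto simp: mem_type_set)
    have Dq: "po_le P q r \<and> r \<noteq> q" if "r \<in> type_set P X ?D" for r
      using that False type_set_mono[of ?D C] Trim_type[OF C] by auto
    have "p \<notin> type_set P X ?D" using Dq pq po_le_antisym[OF po] by metis
    then have "?D \<inter> X p \<subseteq> B" using Trim_elems[OF B(3)] by (auto simp: mem_type_set)
    then have new: "B \<union> ?D \<in> Trim W P X p"
      using B(3) D Dq pq po_le_trans[OF po] by (intro Trim_Un) blast+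
    let ?G = "insert (B \<union> ?D) (F - {B})"
    have "disjnt (B \<union> ?D) E \<and> disjnt E (B \<union> ?D)" if "E \<in> F - {B}" for E
      using that pairwiseD[OF F(2) B(1), of E] by (auto simp: disjnt_def)
    moreover have "disjoint (F - {B})" using F(2) by (rule pairwise_subset) blast
    ultimately have "disjoint ?G" unfolding pairwise_insert by simp
    moreover have "\<Union>?G = \<Union>F \<union> C" using B(1) by blast
    moreover have "\<forall>B\<in>?G. \<exists>p. B \<in> Trim W P X p" using new F(3) by blast
    ultimately show ?thesis using F(1) by (intro exI[of _ ?G]) auto
  qed
qed

lemma finite_disjoint_trim_decomposition:
  assumes A: "A \<in> Co W"
  obtains F where "finite F" "disjoint F" "\<And>B. B \<in> F \<Longrightarrow> \<exists>p. B \<in> Trim W P X p" "\<Union>F = A"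
proof -
  let ?trims = "{B. (\<exists>p. B \<in> Trim W P X p) \<and> B \<subseteq> A}"
  have "A \<subseteq> \<Union>?trims"
  proof
    fix w assume "w \<in> A"
    then obtain p B where "B \<in> Trim W P X p" "w \<in> B" "B \<subseteq> A"
      using T1_base[OF Co_openin[OF A]] by metis
    then show "w \<in> \<Union>?trims" by blast
  qed
  moreover have "openin W B" if "B \<in> ?trims" for B using that Trim_openin by blast
  ultimately have "\<exists>G. finite G \<and> G \<subseteq> ?trims \<and> A \<subseteq> \<Union>G"
    by (intro compactinD[OF Co_compactin[OF A]])
  then obtain G where G: "finite G" "G \<subseteq> ?trims" "A \<subseteq> \<Union>G" by blast
  have "\<exists>F. finite F \<and> disjoint F \<and> (\<forall>B\<in>F. \<exists>p. B \<in> Trim W P X p) \<and> \<Union>F = \<Union>G"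
    using G(1,2)
  proof (induction G rule: finite_induct)
    case empty
    then show ?case by (intro exI[of _ "{}"]) auto
  next
    case (insert C G)
    have "G \<subseteq> ?trims" using insert.prems by simp
    from insert.IH[OF this] obtain F where F: "finite F" "disjoint F"
      "\<forall>B\<in>F. \<exists>p. B \<in> Trim W P X p" "\<Union>F = \<Union>G"
      by (elim exE conjE)
    obtain q where "C \<in> Trim W P X q" using insert.prems by blast
    from trim_union_disjoint_piece[OF F(1,2) bspec[OF F(3)] this] F(4)
    show ?case by (simp add: Un_commute)
  qed
  moreover have "\<Union>G = A" using G by blast
  ultimately show ?thesis using that by auto
qed

end

locale stone_trim_partition = omega_stone W for W :: "'w topology" +
  fixes P :: "'p po_system" and X :: "'p \<Rightarrow> 'w set"
  assumes trim: "trim_partition W P X"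

sublocale stone_trim_partition \<subseteq> stone_T1_partition W P X
  using trim by unfold_locales (auto simp: trim_partition_def)

context stone_trim_partition
begin

text \<open>Every point \<open>y\<close> of \<open>X\<^sub>p\<close> has a \<open>p\<close>-trim neighbourhood, and its compact open subsets
  containing \<open>y\<close> are \<open>p\<close>-trim as well.\<close>

lemma X_trim_nbhd:
  assumes "openin W U" "y \<in> U" "y \<in> X p" "p \<in> elems P"
  shows "\<exists>A\<in>Trim W P X p. y \<in> A \<and> A \<subseteq> U"
proof -
  have "clean W P X y"
    using trim assms by (auto simp: trim_partition_def T3_cond_def union_of_family_def)
  then obtain A where A: "A \<in> Trim W P X p" "y \<in> A"
    using assms X_unique unfolding clean_def by metis
  obtain B where B: "B \<in> Co W" "y \<in> B" "B \<subseteq> U \<inter> A"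
    using Co_base[OF openin_Int[OF assms(1) Trim_openin[OF A(1)]]] assms(2) A(2) by blast
  have "B \<in> Trim W P X p"
    using A(1) B assms by (intro Trim_subset[OF A(1)]) (auto simp: mem_type_set)
  then show ?thesis using B by blast
qed

lemma X_trim_exists:
  assumes "p \<in> elems P"
  shows "\<exists>A. A \<in> Trim W P X p"
proof -
  obtain y where y: "y \<in> X p" using X_nonempty[OF assms] by blast
  then have "y \<in> topspace W" using X_topspace[OF assms] by blast
  then show ?thesis using X_trim_nbhd[OF openin_topspace _ y assms] by blast
qed

lemma trim_nbhd_base_imp_X:
  assumes "p \<in> elems P" "w \<in> topspace W"
    and "\<And>U. openin W U \<Longrightarrow> w \<in> U \<Longrightarrow> \<exists>A\<in>Trim W P X p. w \<in> A \<and> A \<subseteq> U"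
  shows "w \<in> X p"
proof -
  obtain A where "A \<in> Trim W P X p" using assms(2,3) openin_topspace by blast
  then have "p \<in> trim_labels W P X" using assms(1) by (auto simp: trim_labels_def)
  then show ?thesis using trim assms unfolding trim_partition_def T2_cond_def by blast
qed

text \<open>There are countably many trim sets, and each determines its label.\<close>

lemma countable_elems: "countable (elems P)"
proof -
  define t where "t A = (THE p. A \<in> Trim W P X p)" for A
  have "p \<in> t ` Co W" if p: "p \<in> elems P" for p
  proof -
    obtain A where A: "A \<in> Trim W P X p" using X_trim_exists[OF p] by blast
    have "t A = p" unfolding t_def
      using A Trim_type_mono[OF _ _ order_refl] po_le_antisym[OF po] by (intro the_equality) blast+
    then show ?thesis using Trim_Co[OF A] by blast
  qed
  then show ?thesis by (meson countable_Co countable_image countable_subset subsetI)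
qed

section \<open>The ideal of a point\<close>

text \<open>A set of any label \<open>q\<close> that is admissible at \<open>w\<close> can be found inside any neighbourhood \<open>U\<close>
  of \<open>w\<close> that meets \<open>X\<^sub>q\<close>: adjoin a small \<open>q\<close>-trim set inside \<open>U\<close> to a small trim neighbourhood
  of \<open>w\<close>.\<close>

lemma trim_nbhd_of_label:
  assumes q: "q \<in> point_ideal W P X w" and U: "openin W U" "w \<in> U" and meets: "q \<in> type_set P X U"
  shows "\<exists>A\<in>Trim W P X q. w \<in> A \<and> A \<subseteq> U"
proof -
  obtain C where C: "C \<in> Trim W P X q" "w \<in> C" using q by (auto simp: mem_point_ideal)
  obtain r D where D: "D \<in> Trim W P X r" "w \<in> D" "D \<subseteq> C \<inter> U"
    using T1_base[OF openin_Int[OF Trim_openin[OF C(1)] U(1)]] U(2) C(2) by blast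
  have qr: "po_le P q r" using Trim_type_mono[OF C(1) D(1)] D(3) by blast
  show ?thesis
  proof (cases "q = r")
    case False
    obtain y where y: "y \<in> U" "y \<in> X q" "q \<in> elems P" using meets by (auto simp: mem_type_set)
    then obtain B where B: "B \<in> Trim W P X q" "B \<subseteq> U" using X_trim_nbhd[OF U(1)] by metis
    have "q \<notin> type_set P X D"
      using False qr Trim_type[OF D(1)] po_le_antisym[OF po] by blast
    then have "D \<inter> X q = {}" using y(3) by (auto simp: mem_type_set)
    then have "B \<union> D \<in> Trim W P X q"
      using B(1) Trim_Co[OF D(1)] Trim_type[OF D(1)] qr po_le_trans[OF po]
      by (intro Trim_Un) blast+
    then show ?thesis using B D by blast
  qed (use D in blast)
qed

text \<open>The union of a trim set containing \<open>w\<close> with any trim set of a smaller label \<open>q\<close> is again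
  \<open>q\<close>-trim.\<close>

lemma point_ideal_lower:
  assumes p: "p \<in> point_ideal W P X w" and qp: "po_le P q p"
  shows "q \<in> point_ideal W P X w"
proof (cases "p = q")
  case False
  obtain A where A: "A \<in> Trim W P X p" "w \<in> A" using p by (auto simp: mem_point_ideal)
  have q: "q \<in> elems P" using qp by (simp add: po_le_def)
  then obtain B where B: "B \<in> Trim W P X q" using X_trim_exists by blast
  have "q \<notin> type_set P X A" using False qp Trim_type[OF A(1)] po_le_antisym[OF po] by blast
  then have "A \<inter> X q = {}" using q by (auto simp: mem_type_set)
  then have "B \<union> A \<in> Trim W P X q"
    using B Trim_Co[OF A(1)] Trim_type[OF A(1)] qp po_le_trans[OF po] by (intro Trim_Un) blast+
  then show ?thesis using A by (auto simp: mem_point_ideal)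
qed (use p in simp)

lemma po_ideal_point_ideal:
  assumes w: "w \<in> topspace W"
  shows "po_ideal P (point_ideal W P X w)"
  unfolding po_ideal_def
proof (intro conjI ballI allI impI)
  show "point_ideal W P X w \<noteq> {}" using T1_base[OF openin_topspace w] by blast
  show "point_ideal W P X w \<subseteq> elems P" by (auto simp: point_ideal_def)
next
  fix p q assume "p \<in> point_ideal W P X w" "po_le P q p"
  then show "q \<in> point_ideal W P X w" by (rule point_ideal_lower)
next
  fix p q assume "p \<in> point_ideal W P X w" "q \<in> point_ideal W P X w"
  then obtain A B where A: "A \<in> Trim W P X p" "w \<in> A" and B: "B \<in> Trim W P X q" "w \<in> B"
    by (auto simp: mem_point_ideal)
  have "openin W (A \<inter> B)" using A B Trim_openin by blast
  then obtain r C where "r \<in> point_ideal W P X w" and C: "C \<in> Trim W P X r" "C \<subseteq> A \<inter> B"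
    using T1_base[of "A \<inter> B" w] A(2) B(2) by blast
  moreover have "po_le P p r" "po_le P q r"
    using Trim_type_mono[OF A(1) C(1)] Trim_type_mono[OF B(1) C(1)] C(2) by blast+
  ultimately show "\<exists>r\<in>point_ideal W P X w. po_le P p r \<and> po_le P q r" by blast
qed

text \<open>If \<open>I\<^sub>w\<close> is the principal ideal of \<open>p\<close>, then the trim sets inside a fixed \<open>p\<close>-trim
  neighbourhood of \<open>w\<close> that contain \<open>w\<close> have label \<open>p\<close>, and T2 puts \<open>w\<close> into \<open>X\<^sub>p\<close>.\<close>

lemma X_iff_point_ideal:
  assumes p: "p \<in> elems P" and w: "w \<in> topspace W"
  shows "w \<in> X p \<longleftrightarrow> point_ideal W P X w = po_down P p"
proof
  assume wp: "w \<in> X p"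
  obtain A where A: "A \<in> Trim W P X p" "w \<in> A" using X_trim_nbhd[OF openin_topspace w wp p] by blast
  show "point_ideal W P X w = po_down P p"
  proof
    show "point_ideal W P X w \<subseteq> po_down P p"
    proof
      fix q assume "q \<in> point_ideal W P X w"
      then obtain B where B: "B \<in> Trim W P X q" "w \<in> B" by (auto simp: mem_point_ideal)
      then have "p \<in> type_set P X B" using wp p by (auto simp: mem_type_set)
      then show "q \<in> po_down P p" using Trim_type[OF B(1)] by (simp add: mem_po_down)
    qed
    show "po_down P p \<subseteq> point_ideal W P X w"
    proof -
      have "p \<in> point_ideal W P X w" using A by (auto simp: mem_point_ideal)
      then show ?thesis using point_ideal_lower by (auto simp: mem_po_down)
    qed
  qed
next
  assume I: "point_ideal W P X w = po_down P p"
  then have "p \<in> point_ideal W P X w" using po_down_self[OF p] by simp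
  then obtain A where A: "A \<in> Trim W P X p" "w \<in> A" by (auto simp: mem_point_ideal)
  show "w \<in> X p"
  proof (rule trim_nbhd_base_imp_X[OF p w])
    fix U assume U: "openin W U" "w \<in> U"
    then have "openin W (A \<inter> U)" using Trim_openin[OF A(1)] by blast
    then obtain q C where q: "q \<in> point_ideal W P X w" and C: "C \<in> Trim W P X q" "w \<in> C" "C \<subseteq> A \<inter> U"
      using T1_base[of "A \<inter> U" w] A(2) U(2) by blast
    have "po_le P p q" using Trim_type_mono[OF A(1) C(1)] C(3) by blast
    moreover have "po_le P q p" using q I by (simp add: mem_po_down)
    ultimately have "q = p" using po_le_antisym[OF po] by blast
    then show "\<exists>A\<in>Trim W P X p. w \<in> A \<and> A \<subseteq> U" using C by blast
  qed
qed

lemma nested_trim_step: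
  assumes A: "A \<in> Trim W P X p" and pq: "po_le P p q" and B: "B \<in> Co W"
  shows "\<exists>C. C \<in> Trim W P X q \<and> C \<subseteq> A \<and> (C \<subseteq> B \<or> C \<inter> B = {})"
proof -
  obtain y where y: "y \<in> A" "y \<in> X q" and q: "q \<in> elems P"
    using Trim_type[OF A] pq by (auto simp: mem_type_set)
  let ?U = "if y \<in> B then A \<inter> B else A - B"
  have "openin W ?U"
    using Co_openin[OF Co_Int[OF Trim_Co[OF A] B]] Co_openin[OF Co_Diff[OF Trim_Co[OF A] B]] by simp
  moreover have "y \<in> ?U" using y by simp
  ultimately obtain C where "C \<in> Trim W P X q" "y \<in> C" "C \<subseteq> ?U"
    using X_trim_nbhd[OF _ _ y(2) q] by blast
  then show ?thesis by (auto split: if_splits)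
qed

text \<open>Every ideal \<open>J\<close> is the ideal of a point, and such points lie in every trim set whose label
  is in \<open>J\<close>. Choose nested trim sets whose labels run through a cofinal sequence in \<open>J\<close>, the
  \<open>n\<close>-th one being inside or disjoint from the \<open>n\<close>-th compact open set. They form a neighbourhood base of their
  common point, so the ideal of that point is generated by their labels.\<close>

lemma exists_point_of_ideal:
  assumes A: "A \<in> Trim W P X r" and J: "po_ideal P J" and r: "r \<in> J"
  obtains w where "w \<in> A" "point_ideal W P X w = J"
proof -
  have "countable J" using countable_elems J by (meson countable_subset po_ideal_def)
  then obtain s where s: "s 0 = r" "\<And>n. s n \<in> J" "\<And>n. po_le P (s n) (s (Suc n))"
    "\<And>p. p \<in> J \<Longrightarrow> \<exists>n. po_le P p (s n)"
    using po_ideal_cofinal_sequence[OF po J _ r] by metis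
  define C where "C = rec_nat A (\<lambda>n D. SOME E. E \<in> Trim W P X (s (Suc n)) \<and> E \<subseteq> D \<and>
      (E \<subseteq> Co_enum n \<or> E \<inter> Co_enum n = {}))"
  have C0: "C 0 = A" by (simp add: C_def)
  have step: "C (Suc n) \<in> Trim W P X (s (Suc n)) \<and> C (Suc n) \<subseteq> C n \<and>
      (C (Suc n) \<subseteq> Co_enum n \<or> C (Suc n) \<inter> Co_enum n = {})" if "C n \<in> Trim W P X (s n)" for n
    using someI_ex[OF nested_trim_step[OF that s(3) Co_enum_in]] by (simp add: C_def)
  have C: "C n \<in> Trim W P X (s n)" for n
    by (induction n) (use A C0 s(1) step in auto)
  have "(\<Inter>n. C n) \<noteq> {}"
    using C Trim_Co Trim_nonempty step by (intro nested_Co_nonempty) blast+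
  then obtain w where w: "w \<in> C n" for n by blast
  have "point_ideal W P X w = J"
  proof
    show "J \<subseteq> point_ideal W P X w"
    proof
      fix p assume "p \<in> J"
      then obtain n where "po_le P p (s n)" using s(4) by blast
      moreover have "s n \<in> point_ideal W P X w" using C w by (auto simp: mem_point_ideal)
      ultimately show "p \<in> point_ideal W P X w" by (rule point_ideal_lower[rotated])
    qed
    show "point_ideal W P X w \<subseteq> J"
    proof
      fix p assume "p \<in> point_ideal W P X w"
      then obtain B where B: "B \<in> Trim W P X p" "w \<in> B" by (auto simp: mem_point_ideal)
      then obtain n where "Co_enum n = B" using Co_enum_surj Trim_Co by blast
      then have "C (Suc n) \<subseteq> B" using step[OF C] w[of "Suc n"] B(2) by blast
      then have "po_le P p (s (Suc n))" using Trim_type_mono[OF B(1) C] by blast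
      then show "p \<in> J" using po_ideal_lower[OF J s(2)] by blast
    qed
  qed
  then show ?thesis using that w[of 0] C0 by blast
qed

end
section \<open>The ideal completion of a trim partition\<close>

context stone_trim_partition
begin

abbreviation idP where "idP \<equiv> ideal_completion P"
abbreviation idX where "idX \<equiv> id_partition W P X"

lemma mem_idX: "w \<in> idX J \<longleftrightarrow> w \<in> topspace W \<and> point_ideal W P X w = J"
  by (simp add: id_partition_def)

lemma idX_po_down: "p \<in> elems P \<Longrightarrow> idX (po_down P p) = X p"
  using X_iff_point_ideal X_topspace unfolding set_eq_iff mem_idX by blast

lemma union_idX: "union_of_family idP idX = topspace W"
  using po_ideal_point_ideal by (auto simp: union_of_family_def mem_idX)

text \<open>If \<open>K \<subseteq> J\<close>, each trim neighbourhood of a point \<open>w\<close> with \<open>I\<^sub>w = K\<close> contains a point of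
  ideal \<open>J\<close>. When \<open>J = K\<close> this could be \<open>w\<close> itself, so the neighbourhood is first replaced by a trim
  part that avoids \<open>w\<close> and has its label in \<open>J\<close>. Such a part surrounds any point \<open>z \<noteq> w\<close> of some \<open>X\<^sub>q\<close>
  with \<open>q \<in> J\<close>; there is one because either \<open>J\<close> is not principal and \<open>w\<close> is in no \<open>X\<^sub>q\<close>, or \<open>J\<close> is
  generated by some \<open>p < p\<close> and \<open>X\<^sub>p\<close> accumulates at \<open>w\<close>.\<close>

lemma limit_point_idX:
  assumes w: "w \<in> topspace W" and rel: "(point_ideal W P X w, J) \<in> rel idP"
  shows "w \<in> W derived_set_of idX J"
proof -
  let ?K = "point_ideal W P X w"
  have J: "po_ideal P J" and K: "po_ideal P ?K" and KJ: "?K \<subseteq> J"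
    and neq: "?K \<noteq> J \<or> J \<notin> po_down P ` po_d P"
    using rel by (auto simp: ideal_completion_def)
  have "\<exists>y. y \<noteq> w \<and> y \<in> idX J \<and> y \<in> U" if U: "w \<in> U" "openin W U" for U
  proof -
    obtain r A where r: "r \<in> ?K" and A: "A \<in> Trim W P X r" "w \<in> A" "A \<subseteq> U"
      using T1_base[OF U(2,1)] by blast
    have rJ: "r \<in> J" using r KJ by blast
    show ?thesis
    proof (cases "?K = J")
      case False
      obtain y where "y \<in> A" "point_ideal W P X y = J" using exists_point_of_ideal[OF A(1) J rJ] .
      then show ?thesis
        using A False Co_subset_topspace[OF Trim_Co[OF A(1)]] by (intro exI[of _ y]) (auto simp: mem_idX)
    next
      case True
      have "\<exists>q\<in>J. \<exists>z\<in>A \<inter> X q. z \<noteq> w"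
      proof (cases "\<exists>p\<in>elems P. J = po_down P p")
        case True
        then obtain p where p: "p \<in> elems P" and Jp: "J = po_down P p" by blast
        then have "p \<notin> po_d P" using neq \<open>?K = J\<close> by blast
        then have "(p, p) \<in> rel P" using p by (simp add: po_d_def)
        moreover have "w \<in> X p" using X_iff_point_ideal[OF p w] \<open>?K = J\<close> Jp by simp
        then have "p \<in> type_set P X A" using A p by (auto simp: mem_type_set)
        ultimately obtain z where "z \<in> A \<inter> X p" "z \<noteq> w"
          using meets_above_outside_finite[OF Trim_openin[OF A(1)], of p p "{w}"] by auto
        then show ?thesis using Jp po_down_self[OF p] by blast
      next
        case False
        have "r \<in> elems P" using po_ideal_elems[OF J rJ] .
        then obtain z where z: "z \<in> A" "z \<in> X r" using Trim_meets[OF A(1)] by (auto simp: mem_type_set)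
        have "z \<noteq> w" using X_iff_point_ideal[OF \<open>r \<in> elems P\<close> w] False \<open>?K = J\<close> \<open>r \<in> elems P\<close> z by blast
        then show ?thesis using z rJ by blast
      qed
      then obtain q z where q: "q \<in> J" and z: "z \<in> A - {w}" "z \<in> X q" by blast
      have "openin W (A - {w})" using openin_minus_finite[OF Trim_openin[OF A(1)]] by simp
      then obtain B where B: "B \<in> Trim W P X q" "B \<subseteq> A - {w}"
        using X_trim_nbhd[OF _ z po_ideal_elems[OF J q]] by blast
      obtain y where "y \<in> B" "point_ideal W P X y = J" using exists_point_of_ideal[OF B(1) J q] .
      then show ?thesis
        using A B Co_subset_topspace[OF Trim_Co[OF A(1)]] by (intro exI[of _ y]) (auto simp: mem_idX)
    qed
  qed
  then show ?thesis using w by (auto simp: in_derived_set_of)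
qed

lemma limit_point_idX_rel:
  assumes J: "po_ideal P J" and w: "w \<in> W derived_set_of idX J"
  shows "(point_ideal W P X w, J) \<in> rel idP"
proof -
  let ?K = "point_ideal W P X w"
  have wW: "w \<in> topspace W" using w by (simp add: in_derived_set_of)
  have KJ: "?K \<subseteq> J"
  proof
    fix r assume "r \<in> ?K"
    then obtain A where A: "A \<in> Trim W P X r" "w \<in> A" by (auto simp: mem_point_ideal)
    then obtain y where "y \<in> A" "y \<in> idX J"
      using w Trim_openin[OF A(1)] unfolding in_derived_set_of by metis
    then show "r \<in> J" using A by (auto simp: mem_idX mem_point_ideal)
  qed
  have False if KJ: "?K = J" and "J \<in> po_down P ` po_d P"
  proof -
    obtain p where p: "p \<in> po_d P" "J = po_down P p" using \<open>J \<in> po_down P ` po_d P\<close> by blast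
    then have pe: "p \<in> elems P" "(p, p) \<notin> rel P" by (auto simp: po_d_def)
    have "w \<in> X p" using X_iff_point_ideal[OF pe(1) wW] KJ p by simp
    moreover have "w \<in> W derived_set_of X p" using w idX_po_down[OF pe(1)] p by simp
    ultimately show False using derived_iff pe by blast
  qed
  then show ?thesis using J KJ po_ideal_point_ideal[OF wW] by (auto simp: ideal_completion_def)
qed

lemma PO_partition_id: "PO_partition W idP idX"
  unfolding PO_partition_def
proof (intro conjI ballI)
  show "po_system idP" by (rule po_system_ideal_completion)
  show "disjoint_family_on idX (elems idP)" by (auto simp: disjoint_family_on_def mem_idX)
next
  fix J assume "J \<in> elems idP"
  then have J: "po_ideal P J" by simp
  then obtain p where p: "p \<in> J" by (auto simp: po_ideal_def)
  obtain A where A: "A \<in> Trim W P X p" using X_trim_exists[OF po_ideal_elems[OF J p]] by blast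
  obtain w where "w \<in> A" "point_ideal W P X w = J" using exists_point_of_ideal[OF A J p] .
  then have "w \<in> idX J" using Co_subset_topspace[OF Trim_Co[OF A]] by (auto simp: mem_idX)
  then show "idX J \<noteq> {}" by blast
  show "idX J \<subseteq> topspace W" by (auto simp: mem_idX)
  have "w \<in> W derived_set_of idX J \<longleftrightarrow> w \<in> (\<Union>K\<in>{K \<in> elems idP. (K, J) \<in> rel idP}. idX K)" for w
  proof (cases "w \<in> topspace W")
    case True
    then have "w \<in> W derived_set_of idX J \<longleftrightarrow> (point_ideal W P X w, J) \<in> rel idP"
      using limit_point_idX limit_point_idX_rel[OF J] by blast
    then show ?thesis using True po_ideal_point_ideal[OF True] by (auto simp: mem_idX)
  qed (auto simp: in_derived_set_of mem_idX)
  then show "W derived_set_of idX J \<inter> union_of_family idP idX =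
      (\<Union>K\<in>{K \<in> elems idP. (K, J) \<in> rel idP}. idX K)"
    using derived_set_of_subset_topspace[of W "idX J"] unfolding union_idX by blast
qed

end

sublocale stone_trim_partition \<subseteq> id: stone_partition W "ideal_completion P" "id_partition W P X"
  by unfold_locales (rule PO_partition_id)

context stone_trim_partition
begin

lemma mem_type_set_id:
  assumes "A \<in> Co W"
  shows "J \<in> type_set idP idX A \<longleftrightarrow> po_ideal P J \<and> (\<exists>w\<in>A. point_ideal W P X w = J)"
  using Co_subset_topspace[OF assms] by (auto simp: id.mem_type_set mem_idX)

lemma type_set_id_po_down:
  assumes "A \<in> Co W" "p \<in> elems P"
  shows "po_down P p \<in> type_set idP idX A \<longleftrightarrow> p \<in> type_set P X A"
  using assms po_ideal_down[OF po] by (simp add: id.mem_type_set mem_type_set idX_po_down)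

text \<open>The completion has the same trim sets as \<open>X\<close>: the ideals of the points of a \<open>p\<close>-trim set are
  exactly those that contain \<open>p\<close>, and conversely a set whose ideals have a least element \<open>J\<close>
  contains a trim set around a point of ideal \<open>J\<close>, whose label must generate \<open>J\<close>.\<close>

lemma Trim_imp_id_Trim:
  assumes A: "A \<in> Trim W P X p"
  shows "A \<in> Trim W idP idX (po_down P p)"
proof (rule id.TrimI)
  have p: "p \<in> elems P" using Trim_elems[OF A] .
  show Co: "A \<in> Co W" using Trim_Co[OF A] .
  show "po_down P p \<in> type_set idP idX A"
    using type_set_id_po_down[OF Co p] Trim_meets[OF A] by simp
  show "po_le idP (po_down P p) J" if "J \<in> type_set idP idX A" for J
  proof -
    have "po_ideal P J" "p \<in> J" using that A by (auto simp: mem_type_set_id[OF Co] mem_point_ideal)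
    then show ?thesis
      using po_down_subset_ideal[OF po _ p] po_ideal_down[OF po p] by (simp add: po_le_ideal_completion)
  qed
  assume "po_down P p \<in> po_d idP"
  then obtain q where "q \<in> po_d P" "po_down P p = po_down P q" by (auto simp: po_d_ideal_completion[OF po])
  then have "p \<in> po_d P" using po_down_eq_iff[OF po p, of q] by (auto simp: po_d_def)
  then show "card (A \<inter> idX (po_down P p)) = 1" using Trim_card[OF A] idX_po_down[OF p] by simp
qed

lemma id_Trim_imp_Trim:
  assumes A: "A \<in> Trim W idP idX J"
  shows "\<exists>p\<in>elems P. J = po_down P p \<and> A \<in> Trim W P X p"
proof -
  have Co: "A \<in> Co W" using id.Trim_Co[OF A] .
  obtain w where w: "w \<in> A" "point_ideal W P X w = J"
    using id.Trim_meets[OF A] mem_type_set_id[OF Co] by blast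
  obtain p B where p: "p \<in> J" and B: "B \<in> Trim W P X p" "B \<subseteq> A"
    using T1_base[OF Co_openin[OF Co] w(1)] w(2) by blast
  have J: "po_ideal P J" using id.Trim_elems[OF A] by simp
  have pe: "p \<in> elems P" using Trim_elems[OF B(1)] .
  have "p \<in> type_set P X A" using Trim_meets[OF B(1)] type_set_mono[OF B(2)] by blast
  then have "po_le idP J (po_down P p)"
    using type_set_id_po_down[OF Co pe] id.Trim_type[OF A] by blast
  then have Jp: "J = po_down P p"
    using po_down_subset_ideal[OF po J pe] p by (auto simp: po_le_ideal_completion)
  have "A \<in> Trim W P X p"
  proof (rule TrimI)
    show "A \<in> Co W" "p \<in> type_set P X A" by fact+
    show "po_le P p q" if "q \<in> type_set P X A" for q
    proof -
      have q: "q \<in> elems P" using that by (simp add: mem_type_set)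
      then have "po_le idP J (po_down P q)"
        using that type_set_id_po_down[OF Co q] id.Trim_type[OF A] by blast
      then show ?thesis using Jp po_down_subset_iff[OF po pe] by (simp add: po_le_ideal_completion)
    qed
    assume "p \<in> po_d P"
    then have "J \<in> po_d idP" using Jp by (simp add: po_d_ideal_completion[OF po])
    then show "card (A \<inter> X p) = 1" using id.Trim_card[OF A] Jp idX_po_down[OF pe] by simp
  qed
  then show ?thesis using Jp pe by blast
qed

lemma T1_id: "T1_cond W idP idX"
  unfolding T1_cond_def
proof (intro ballI allI impI)
  fix w U assume "w \<in> topspace W" "openin W U \<and> w \<in> U"
  then obtain p A where "A \<in> Trim W P X p" "w \<in> A" "A \<subseteq> U" using T1_base by metis
  then show "\<exists>J\<in>elems idP. \<exists>A\<in>Trim W idP idX J. w \<in> A \<and> A \<subseteq> U"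
    using Trim_imp_id_Trim id.Trim_elems by blast
qed

lemma trim_labels_id: "trim_labels W idP idX = po_down P ` elems P"
proof
  show "trim_labels W idP idX \<subseteq> po_down P ` elems P"
    using id_Trim_imp_Trim by (auto simp: trim_labels_def)
  show "po_down P ` elems P \<subseteq> trim_labels W idP idX"
    using X_trim_exists Trim_imp_id_Trim po_ideal_down[OF po] by (fastforce simp: trim_labels_def)
qed

lemma id_Trim_po_down:
  assumes "p \<in> elems P"
  shows "Trim W idP idX (po_down P p) = Trim W P X p"
  using Trim_imp_id_Trim id_Trim_imp_Trim po_down_eq_iff[OF po] assms by blast

lemma clean_interior_id:
  assumes p: "p \<in> elems P"
  shows "clean_interior W idP idX (po_down P p) = X p"
proof -
  have "clean W idP idX w" if w: "w \<in> X p" for w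
  proof -
    have "w \<in> topspace W" using X_topspace[OF p] w by blast
    then obtain A where "A \<in> Trim W P X p" "w \<in> A" using X_trim_nbhd[OF openin_topspace _ w p] by blast
    then show ?thesis
      using Trim_imp_id_Trim idX_po_down[OF p] w po_ideal_down[OF po p] unfolding clean_def
      by (intro bexI[of _ "po_down P p"]) auto
  qed
  then show ?thesis using idX_po_down[OF p] by (auto simp: clean_interior_def)
qed

lemma semi_trim_id: "semi_trim_partition W idP idX"
  unfolding semi_trim_partition_def
proof (intro conjI PO_partition_id T1_id)
  show "T2_cond W idP idX"
    unfolding T2_cond_def
  proof (intro ballI impI)
    fix J w assume J: "J \<in> trim_labels W idP idX" and w: "w \<in> topspace W"
      and base: "\<forall>U. openin W U \<and> w \<in> U \<longrightarrow> (\<exists>A\<in>Trim W idP idX J. w \<in> A \<and> A \<subseteq> U)"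
    obtain p where p: "p \<in> elems P" "J = po_down P p" using J trim_labels_id by blast
    then have "w \<in> X p"
      using base w id_Trim_po_down[OF p(1)] by (intro trim_nbhd_base_imp_X) auto
    then show "w \<in> idX J" using p idX_po_down by simp
  qed
  show "ST3_cond W idP idX"
    unfolding ST3_cond_def
  proof
    fix J assume "J \<in> trim_labels W idP idX"
    then obtain p where p: "p \<in> elems P" "J = po_down P p" using trim_labels_id by blast
    then have "clean_interior W idP idX J = idX J" using clean_interior_id idX_po_down by simp
    then show "idX J \<subseteq> W closure_of clean_interior W idP idX J"
      by (simp add: closure_of_subset id_partition_def)
  qed
qed

lemma elems_principal_po [simp]: "elems (principal_po P) = po_down P ` elems P"
  by (simp add: principal_po_def)

lemma as_principal_po_down: "p \<in> elems P \<Longrightarrow> as_principal P X (po_down P p) = X p"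
  by (simp add: as_principal_def inv_into_f_f[OF inj_on_po_down[OF po]])

theorem clean_interior_eq_id:
  "clean_interior_eq W idP idX (elems (principal_po P)) (as_principal P X)"
  by (auto simp: clean_interior_eq_def semi_trim_id trim_labels_id clean_interior_id as_principal_po_down)

lemma rel_principal_po:
  "p \<in> elems P \<Longrightarrow> q \<in> elems P \<Longrightarrow> (po_down P p, po_down P q) \<in> rel (principal_po P) \<longleftrightarrow> (p, q) \<in> rel P"
  using rel_elems[OF po] po_down_eq_iff[OF po] by (fastforce simp: principal_po_def)

lemma Trim_principal:
  assumes p: "p \<in> elems P"
  shows "Trim W (principal_po P) (as_principal P X) (po_down P p) = Trim W P X p"
proof -
  have ty: "type_set (principal_po P) (as_principal P X) A = po_down P ` type_set P X A" for A
  proof -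
    have "type_set (principal_po P) (as_principal P X) A =
        po_down P ` {p \<in> elems P. A \<inter> as_principal P X (po_down P p) \<noteq> {}}"
      unfolding type_set_def elems_principal_po by blast
    also have "{p \<in> elems P. A \<inter> as_principal P X (po_down P p) \<noteq> {}} = type_set P X A"
      unfolding type_set_def using as_principal_po_down by auto
    finally show ?thesis .
  qed
  have up: "po_up (principal_po P) (po_down P p) = po_down P ` po_up P p"
    using p rel_principal_po po_down_eq_iff[OF po] by (auto simp: po_up_def po_le_def)
  have "type_set (principal_po P) (as_principal P X) A = po_up (principal_po P) (po_down P p) \<longleftrightarrow>
      type_set P X A = po_up P p" for A
    unfolding ty up
    by (intro inj_on_image_eq_iff[OF inj_on_po_down[OF po]]) (auto simp: type_set_def po_up_def po_le_def)
  moreover have "po_down P p \<in> po_d (principal_po P) \<longleftrightarrow> p \<in> po_d P"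
    using p rel_principal_po by (auto simp: po_d_def)
  ultimately show ?thesis using p by (auto simp: Trim_def as_principal_po_down)
qed

text \<open>The principal ideals form a copy of \<open>P\<close>, along which each clause is transported.\<close>

lemma semi_trim_principal: "semi_trim_partition W (principal_po P) (as_principal P X)"
proof -
  have po': "po_system (principal_po P)"
  proof -
    let ?E = "elems (principal_po P) \<times> elems (principal_po P)"
    have rel: "rel (principal_po P) = rel idP \<inter> ?E"
      using po_subsystem_principal[OF po] by (simp add: po_subsystem_def)
    have "antisym (rel idP)" "trans (rel idP)"
      using po_system_ideal_completion[of P] by (auto simp: po_system_def)
    moreover have "trans ?E" by (auto simp: trans_def)
    ultimately show ?thesis
      unfolding po_system_def rel by (blast intro: antisym_subset trans_Int)
  qed
  have "disjoint_family_on (as_principal P X) (elems (principal_po P))"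
    using X_unique by (fastforce simp: disjoint_family_on_def as_principal_po_down)
  moreover have union: "union_of_family (principal_po P) (as_principal P X) = union_of_family P X"
    by (auto simp: union_of_family_def as_principal_po_down)
  moreover have "(\<Union>K\<in>{K \<in> elems (principal_po P). (K, po_down P p) \<in> rel (principal_po P)}. as_principal P X K)
      = (\<Union>q\<in>{q \<in> elems P. (q, p) \<in> rel P}. X q)" if "p \<in> elems P" for p
    using that by (auto simp: as_principal_po_down rel_principal_po)
  ultimately have part: "PO_partition W (principal_po P) (as_principal P X)"
    using partition po' by (simp add: PO_partition_def as_principal_po_down)
  have T1': "T1_cond W (principal_po P) (as_principal P X)"
    using T1 by (auto simp: T1_cond_def Trim_principal)
  have labels: "trim_labels W (principal_po P) (as_principal P X) = po_down P ` elems P"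
  proof -
    have "Trim W (principal_po P) (as_principal P X) (po_down P p) \<noteq> {}" if "p \<in> elems P" for p
      using X_trim_exists[OF that] Trim_principal[OF that] by blast
    then show ?thesis by (auto simp: trim_labels_def)
  qed
  have "T2_cond W (principal_po P) (as_principal P X)"
    unfolding T2_cond_def labels
    by (auto simp: Trim_principal as_principal_po_down intro: trim_nbhd_base_imp_X)
  moreover have "clean_interior W (principal_po P) (as_principal P X) (po_down P p) = X p"
    if p: "p \<in> elems P" for p
  proof -
    have "clean W (principal_po P) (as_principal P X) w" if w: "w \<in> X p" for w
    proof -
      have "w \<in> topspace W" using X_topspace[OF p] w by blast
      then show ?thesis
        using X_trim_nbhd[OF openin_topspace _ w p] w p
        by (auto simp: clean_def Trim_principal as_principal_po_down)
    qed
    then show ?thesis using p by (auto simp: clean_interior_def as_principal_po_down)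
  qed
  then have "ST3_cond W (principal_po P) (as_principal P X)"
    unfolding ST3_cond_def labels by (simp add: as_principal_po_down closure_of_subset X_topspace)
  ultimately show ?thesis using part T1' by (simp add: semi_trim_partition_def)
qed

theorem regularly_extends_id:
  "regularly_extends W idP idX (principal_po P) (as_principal P X)"
  unfolding regularly_extends_def
proof (intro conjI po_subsystem_principal[OF po] PO_partition_id semi_trim_principal ballI)
  fix K assume "K \<in> elems (principal_po P)"
  then show "as_principal P X K \<subseteq> idX K" by (auto simp: as_principal_po_down idX_po_down)
next
  fix A J assume A: "A \<in> Co W" and "J \<in> type_set idP idX A"
  then obtain w where J: "po_ideal P J" and w: "w \<in> A" "point_ideal W P X w = J"
    by (auto simp: mem_type_set_id[OF A])
  obtain p B where p: "p \<in> J" and B: "B \<in> Trim W P X p" "B \<subseteq> A"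
    using T1_base[OF Co_openin[OF A] w(1)] w(2) by blast
  have pe: "p \<in> elems P" using Trim_elems[OF B(1)] .
  have "p \<in> type_set P X A" using Trim_meets[OF B(1)] type_set_mono[OF B(2)] by blast
  then have "po_down P p \<in> type_set (principal_po P) (as_principal P X) A"
    using pe by (simp add: type_set_def as_principal_po_down)
  moreover have "po_le idP (po_down P p) J"
    using po_down_subset_ideal[OF po J pe] p J po_ideal_down[OF po pe] by (simp add: po_le_ideal_completion)
  ultimately show "\<exists>q\<in>type_set (principal_po P) (as_principal P X) A. po_le idP q J" by blast
qed

section \<open>The completion is a rank partition\<close>

lemma label_id:
  assumes "w \<in> topspace W"
  shows "label idP idX w = point_ideal W P X w"
  unfolding label_def by (rule the_equality) (use assms po_ideal_point_ideal in \<open>auto simp: mem_idX\<close>)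

text \<open>A separated label is the principal ideal of some \<open>p\<close>, and the points \<open>x\<close> with \<open>p \<in> I\<^sub>x\<close> form an
  open set, which contains almost all members of a sequence converging to one of its points. For
  the second rank condition, approximate a point of non-principal ideal by points of \<open>X\<close> in shrinking
  trim neighbourhoods.\<close>

theorem rank_partition_id: "rank_partition W idP idX"
  unfolding rank_partition_def
proof (intro conjI allI ballI impI)
  show "complete_partition W idP idX" using PO_partition_id union_idX by (simp add: complete_partition_def)
next
  fix J x and xs :: "nat \<Rightarrow> 'w"
  assume *: "po_separated idP J \<and> x \<in> topspace W \<and> range xs \<subseteq> topspace W \<and>
      limitin W xs x sequentially \<and> po_le idP J (label idP idX x) \<and>
      ((\<forall>i j. \<not> po_less idP (label idP idX (xs i)) (label idP idX (xs j))) \<or>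
       po_strictly_increasing idP (\<lambda>k. label idP idX (xs k)))"
  have sep: "po_separated idP J" using * by (elim conjE)
  have lim: "limitin W xs x sequentially" using * by (elim conjE)
  have xs: "range xs \<subseteq> topspace W" using * by (elim conjE)
  have J: "po_ideal P J" and JI: "J \<subseteq> point_ideal W P X x"
    using * by (auto simp: po_separated_def label_id po_le_ideal_completion)
  obtain p where p: "p \<in> elems P" "J = po_down P p"
    using sep separated_ideal_iff_principal[OF po J countable_elems] by blast
  then have "p \<in> point_ideal W P X x" using JI po_down_self[OF p(1)] p(2) by blast
  then obtain A where A: "A \<in> Trim W P X p" "x \<in> A" by (auto simp: mem_point_ideal)
  then have "\<forall>\<^sub>F k in sequentially. xs k \<in> A"
    using lim Trim_openin[OF A(1)] by (simp add: limitin_def)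
  then obtain N where N: "\<And>k. k \<ge> N \<Longrightarrow> xs k \<in> A" by (auto simp: eventually_sequentially)
  have "po_le idP J (label idP idX (xs k))" if "k \<ge> N" for k
  proof -
    have "xs k \<in> topspace W" using xs by blast
    moreover have "p \<in> point_ideal W P X (xs k)" using A N[OF that] by (auto simp: mem_point_ideal)
    ultimately show ?thesis
      using p J po_ideal_point_ideal po_down_subset_ideal[OF po] by (simp add: label_id po_le_ideal_completion)
  qed
  then have "{k. \<not> po_le idP J (label idP idX (xs k))} \<subseteq> {..<N}" by (auto simp: not_le[symmetric])
  then show "finite {k. \<not> po_le idP J (label idP idX (xs k))}" by (rule finite_subset) simp
next
  fix x assume x: "x \<in> topspace W" and "\<not> po_separated idP (label idP idX x)"
  let ?J = "point_ideal W P X x"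
  have J: "po_ideal P ?J" using po_ideal_point_ideal[OF x] .
  have np: "?J \<notin> po_down P ` elems P"
    using \<open>\<not> po_separated idP _\<close> separated_ideal_iff_principal[OF po J countable_elems] label_id[OF x] by simp
  obtain N :: "nat \<Rightarrow> 'w set" where N': "(\<forall>n. N n \<in> Co W \<and> x \<in> N n) \<and>
      (\<forall>U. openin W U \<and> x \<in> U \<longrightarrow> (\<exists>n. \<forall>m\<ge>n. N m \<subseteq> U))"
    using countable_nested_base[OF x] ..
  note N = spec[OF conjunct1[OF N'], THEN conjunct1] spec[OF conjunct1[OF N'], THEN conjunct2]
    and N3 = spec[OF conjunct2[OF N'], THEN mp, OF conjI]
  have "\<exists>y. y \<in> N n \<and> po_less idP (point_ideal W P X y) ?J" for n
  proof -
    obtain p A where p: "p \<in> ?J" and A: "A \<in> Trim W P X p" "A \<subseteq> N n"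
      using T1_base[OF Co_openin[OF N(1)] N(2)] by blast
    have pe: "p \<in> elems P" using Trim_elems[OF A(1)] .
    obtain y where y: "y \<in> A" "y \<in> X p" using Trim_meets[OF A(1)] by (auto simp: mem_type_set)
    then have "point_ideal W P X y = po_down P p" using X_iff_point_ideal[OF pe] X_topspace[OF pe] by blast
    moreover have "po_down P p \<subset> ?J" using po_down_subset_ideal[OF po J pe] p np pe by blast
    ultimately have "po_less idP (point_ideal W P X y) ?J"
      using J po_ideal_down[OF po pe] by (simp add: po_less_ideal_completion)
    then show ?thesis using y A by blast
  qed
  then obtain ys where ys: "\<And>n. ys n \<in> N n" "\<And>n. po_less idP (point_ideal W P X (ys n)) ?J" by metis
  have top: "ys n \<in> topspace W" for n using ys N Co_subset_topspace by blast
  have "limitin W ys x sequentially"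
    unfolding limitin_def eventually_sequentially using N3 ys(1) x by (meson subsetD)
  then show "\<exists>xs. range xs \<subseteq> topspace W \<and> limitin W xs x sequentially \<and>
      (\<forall>k. po_less idP (label idP idX (xs k)) (label idP idX x))"
    using ys(2) top by (intro exI[of _ ys]) (auto simp: label_id x)
qed

end
section \<open>Back and forth\<close>

context omega_stone
begin

text \<open>A tree of compact open sets, indexed by bit strings with the most recent bit in front, whose
  nodes are split in two at each level and which eventually decides membership in every compact
  open set. Its branches then converge to points.\<close>

definition splitting_tree :: "(bool list \<Rightarrow> 'w set) \<Rightarrow> bool" where
  "splitting_tree s \<longleftrightarrow> (\<forall>b. s b \<in> Co W) \<and>
     (\<forall>b. s (True # b) \<union> s (False # b) = s b \<and> s (True # b) \<inter> s (False # b) = {}) \<and>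
     (\<forall>B\<in>Co W. \<exists>n. \<forall>b. length b = n \<longrightarrow> s b \<subseteq> B \<or> s b \<inter> B = {})"

lemma splitting_tree_Co: "splitting_tree s \<Longrightarrow> s b \<in> Co W"
  and splitting_tree_split: "splitting_tree s \<Longrightarrow> s (True # b) \<union> s (False # b) = s b"
  and splitting_tree_disjoint: "splitting_tree s \<Longrightarrow> s (True # b) \<inter> s (False # b) = {}"
  and splitting_tree_decides:
    "splitting_tree s \<Longrightarrow> B \<in> Co W \<Longrightarrow> \<exists>n. \<forall>b. length b = n \<longrightarrow> s b \<subseteq> B \<or> s b \<inter> B = {}"
  unfolding splitting_tree_def by blast+

lemma splitting_tree_child_subset: "splitting_tree s \<Longrightarrow> s (c # b) \<subseteq> s b"
  using splitting_tree_split[of s b] by (cases c) auto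

lemma splitting_tree_root: "splitting_tree s \<Longrightarrow> s b \<subseteq> s []"
  by (induction b) (use splitting_tree_child_subset in blast)+

lemma splitting_tree_branch:
  assumes s: "splitting_tree s" and x: "x \<in> s []"
  shows "\<exists>\<sigma>. \<forall>n. length (\<sigma> n) = n \<and> x \<in> s (\<sigma> n) \<and> (\<exists>c. \<sigma> (Suc n) = c # \<sigma> n)"
proof -
  define \<sigma> where "\<sigma> = rec_nat [] (\<lambda>n b. (x \<in> s (True # b)) # b)"
  have \<sigma>: "\<sigma> 0 = []" "\<sigma> (Suc n) = (x \<in> s (True # \<sigma> n)) # \<sigma> n" for n by (simp_all add: \<sigma>_def)
  have "length (\<sigma> n) = n \<and> x \<in> s (\<sigma> n)" for n
  proof (induction n)
    case (Suc n)
    then have "x \<in> s (True # \<sigma> n) \<or> x \<in> s (False # \<sigma> n)" using splitting_tree_split[OF s] by blast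
    then show ?case using Suc by (cases "x \<in> s (True # \<sigma> n)") (auto simp: \<sigma>)
  qed (use x \<sigma> in simp)
  then show ?thesis using \<sigma>(2) by blast
qed

lemma splitting_tree_address_unique:
  assumes s: "splitting_tree s"
  shows "length b = length c \<Longrightarrow> x \<in> s b \<Longrightarrow> x \<in> s c \<Longrightarrow> b = c"
proof (induction b c rule: list_induct2)
  case (Cons i b j c)
  then have "x \<in> s b" "x \<in> s c" using splitting_tree_child_subset[OF s] by blast+
  then have "b = c" using Cons by blast
  moreover have "i = j"
    using Cons.prems splitting_tree_disjoint[OF s, of b] \<open>b = c\<close> by (cases i; cases j) auto
  ultimately show ?case by simp
qed simp

lemma splitting_tree_separates:
  assumes s: "splitting_tree s" and x: "x \<in> s []" and y: "\<And>b. x \<in> s b \<Longrightarrow> y \<in> s b"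
  shows "x = y"
proof (rule ccontr)
  assume "x \<noteq> y"
  have "openin W (s [] - {y})"
    using Co_openin[OF splitting_tree_Co[OF s]] by (simp add: openin_minus_finite)
  then obtain B where B: "B \<in> Co W" "x \<in> B" "B \<subseteq> s [] - {y}" using Co_base[of "s [] - {y}" x] x \<open>x \<noteq> y\<close> by blast
  obtain n where n: "\<forall>b. length b = n \<longrightarrow> s b \<subseteq> B \<or> s b \<inter> B = {}"
    using splitting_tree_decides[OF s B(1)] by blast
  obtain \<sigma> where "length (\<sigma> n) = n" "x \<in> s (\<sigma> n)" using splitting_tree_branch[OF s x] by metis
  then have "s (\<sigma> n) \<subseteq> B" "y \<in> s (\<sigma> n)" using n B y by blast+
  then show False using B by blast
qed

text \<open>Two splitting trees that have empty nodes in the same places have the same branches, which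
  gives maps between their roots that respect all nodes.\<close>

lemma splitting_tree_map:
  assumes s: "splitting_tree s" and s': "splitting_tree s'" and ne: "\<And>b. s b \<noteq> {} \<Longrightarrow> s' b \<noteq> {}"
  shows "\<exists>f. \<forall>b. \<forall>x\<in>s b. f x \<in> s' b"
proof -
  have "\<exists>y. \<forall>b. x \<in> s b \<longrightarrow> y \<in> s' b" if x: "x \<in> s []" for x
  proof -
    obtain \<sigma> where \<sigma>: "\<And>n. length (\<sigma> n) = n" "\<And>n. x \<in> s (\<sigma> n)" "\<And>n. \<exists>c. \<sigma> (Suc n) = c # \<sigma> n"
      using splitting_tree_branch[OF s x] by metis
    have "(\<Inter>n. s' (\<sigma> n)) \<noteq> {}"
    proof (rule nested_Co_nonempty)
      show "s' (\<sigma> n) \<in> Co W" "s' (\<sigma> n) \<noteq> {}" for n using splitting_tree_Co[OF s'] ne \<sigma>(2) by blast+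
      show "s' (\<sigma> (Suc n)) \<subseteq> s' (\<sigma> n)" for n using splitting_tree_child_subset[OF s'] \<sigma>(3) by metis
    qed
    then obtain y where y: "\<And>n. y \<in> s' (\<sigma> n)" by blast
    have "y \<in> s' b" if "x \<in> s b" for b
      using splitting_tree_address_unique[OF s, of b "\<sigma> (length b)" x] \<sigma> that y by metis
    then show ?thesis by blast
  qed
  then obtain f where f: "\<And>x b. x \<in> s [] \<Longrightarrow> x \<in> s b \<Longrightarrow> f x \<in> s' b" by metis
  then show ?thesis using splitting_tree_root[OF s] by blast
qed

lemma splitting_tree_map_continuous:
  assumes s: "splitting_tree s" and s': "splitting_tree s'" and f: "\<And>b x. x \<in> s b \<Longrightarrow> f x \<in> s' b"
    and U: "openin W U"
  shows "openin W {x \<in> s []. f x \<in> U}"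
proof (subst openin_subopen, intro ballI)
  fix x assume "x \<in> {x \<in> s []. f x \<in> U}"
  then have x: "x \<in> s []" "f x \<in> U" by auto
  obtain B where B: "B \<in> Co W" "f x \<in> B" "B \<subseteq> U" using Co_base[OF U x(2)] by blast
  obtain n where n: "\<forall>b. length b = n \<longrightarrow> s' b \<subseteq> B \<or> s' b \<inter> B = {}"
    using splitting_tree_decides[OF s' B(1)] by blast
  obtain \<sigma> where \<sigma>: "length (\<sigma> n) = n" "x \<in> s (\<sigma> n)" using splitting_tree_branch[OF s x(1)] by metis
  then have "s' (\<sigma> n) \<subseteq> U" using n f[OF \<sigma>(2)] B by blast
  then have "s (\<sigma> n) \<subseteq> {x \<in> s []. f x \<in> U}" using f splitting_tree_root[OF s] by blast
  then show "\<exists>T. openin W T \<and> x \<in> T \<and> T \<subseteq> {x \<in> s []. f x \<in> U}"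
    using Co_openin[OF splitting_tree_Co[OF s]] \<sigma>(2) by blast
qed

text \<open>Vaught's argument: a relation between compact open sets along which splittings can be copied in
  both directions is induced by a homeomorphism. The two trees are grown together, even levels
  splitting the left tree, and odd levels the right tree, by the sets of an enumeration.\<close>

lemma back_and_forth:
  fixes R :: "'w set \<Rightarrow> 'w set \<Rightarrow> bool"
  assumes Co: "\<And>A A'. R A A' \<Longrightarrow> A \<in> Co W \<and> A' \<in> Co W"
    and empty: "\<And>A A'. R A A' \<Longrightarrow> A = {} \<longleftrightarrow> A' = {}"
    and forth: "\<And>A A' B. R A A' \<Longrightarrow> B \<in> Co W \<Longrightarrow>
      \<exists>D'\<subseteq>A'. R (A \<inter> B) D' \<and> R (A - B) (A' - D')"
    and backward: "\<And>A A' B. R A A' \<Longrightarrow> B \<in> Co W \<Longrightarrow>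
      \<exists>D\<subseteq>A. R D (A' \<inter> B) \<and> R (A - D) (A' - B)"
    and A: "R A A'"
  shows "\<exists>f g. (\<forall>x\<in>A. f x \<in> A' \<and> g (f x) = x) \<and> (\<forall>y\<in>A'. g y \<in> A \<and> f (g y) = y) \<and>
    (\<forall>U. openin W U \<longrightarrow> openin W {x \<in> A. f x \<in> U}) \<and>
    (\<forall>U. openin W U \<longrightarrow> openin W {y \<in> A'. g y \<in> U}) \<and>
    (\<forall>x\<in>A. \<forall>B\<in>Co W. (x \<in> B \<longrightarrow> (\<exists>C C'. R C C' \<and> x \<in> C \<and> C \<subseteq> B \<and> f x \<in> C')) \<and>
      (f x \<in> B \<longrightarrow> (\<exists>C C'. R C C' \<and> x \<in> C \<and> f x \<in> C' \<and> C' \<subseteq> B)))"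
proof -
  have "\<exists>D D'. D \<subseteq> E \<and> D' \<subseteq> E' \<and> R D D' \<and> R (E - D) (E' - D') \<and>
      (even n \<longrightarrow> D = E \<inter> Co_enum (n div 2)) \<and> (odd n \<longrightarrow> D' = E' \<inter> Co_enum (n div 2))"
    if E: "R E E'" for E E' and n :: nat
  proof (cases "even n")
    case True
    obtain D' where "D' \<subseteq> E'" "R (E \<inter> Co_enum (n div 2)) D'" "R (E - Co_enum (n div 2)) (E' - D')"
      using forth[OF E Co_enum_in] by blast
    then show ?thesis using True
      by (intro exI[of _ "E \<inter> Co_enum (n div 2)"] exI[of _ D']) (simp add: Diff_Int)
  next
    case False
    obtain D where "D \<subseteq> E" "R D (E' \<inter> Co_enum (n div 2))" "R (E - D) (E' - Co_enum (n div 2))"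
      using backward[OF E Co_enum_in] by blast
    then show ?thesis using False
      by (intro exI[of _ D] exI[of _ "E' \<inter> Co_enum (n div 2)"]) (simp add: Diff_Int)
  qed
  then obtain d d' where d: "\<And>E E' n. R E E' \<Longrightarrow> d E E' n \<subseteq> E \<and> d' E E' n \<subseteq> E' \<and>
      R (d E E' n) (d' E E' n) \<and> R (E - d E E' n) (E' - d' E E' n) \<and>
      (even n \<longrightarrow> d E E' n = E \<inter> Co_enum (n div 2)) \<and> (odd n \<longrightarrow> d' E E' n = E' \<inter> Co_enum (n div 2))"
    by metis
  define t where "t = rec_list (A, A') (\<lambda>c b p. case p of (E, E') \<Rightarrow>
      if c then (d E E' (length b), d' E E' (length b))
      else (E - d E E' (length b), E' - d' E E' (length b)))"
  define s where "s b = fst (t b)" for b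
  define s' where "s' b = snd (t b)" for b
  have nil: "s [] = A" "s' [] = A'" by (simp_all add: s_def s'_def t_def)
  have True_node: "s (True # b) = d (s b) (s' b) (length b)" "s' (True # b) = d' (s b) (s' b) (length b)"
    and False_node: "s (False # b) = s b - s (True # b)" "s' (False # b) = s' b - s' (True # b)" for b
    by (simp_all add: s_def s'_def t_def split: prod.split)
  have R: "R (s b) (s' b)" for b
  proof (induction b)
    case (Cons c b)
    then show ?case using d[OF Cons, of "length b"] by (cases c) (simp_all add: True_node False_node)
  qed (simp add: nil A)
  note dR = d[OF R]
  have s_split: "s (True # b) \<union> s (False # b) = s b \<and> s (True # b) \<inter> s (False # b) = {}" for b
    using dR[of b "length b"] unfolding False_node True_node by blast
  have s'_split: "s' (True # b) \<union> s' (False # b) = s' b \<and> s' (True # b) \<inter> s' (False # b) = {}" for b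
    using dR[of b "length b"] unfolding False_node True_node by blast
  have s_dec: "s b \<subseteq> Co_enum n \<or> s b \<inter> Co_enum n = {}" if len: "length b = Suc (2 * n)" for b n
  proof -
    obtain c b' where b: "b = c # b'" "length b' = 2 * n" using len by (cases b) auto
    then have "s (True # b') = s b' \<inter> Co_enum n" using dR[of b' "2 * n"] by (simp add: True_node)
    then show ?thesis using b(1) False_node(1)[of b'] by (cases c) auto
  qed
  have s'_dec: "s' b \<subseteq> Co_enum n \<or> s' b \<inter> Co_enum n = {}" if len: "length b = Suc (Suc (2 * n))" for b n
  proof -
    obtain c b' where b: "b = c # b'" "length b' = Suc (2 * n)" using len by (cases b) auto
    then have "s' (True # b') = s' b' \<inter> Co_enum n" using dR[of b' "Suc (2 * n)"] by (simp add: True_node)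
    then show ?thesis using b(1) False_node(2)[of b'] by (cases c) auto
  qed
  have tree: "splitting_tree s"
    unfolding splitting_tree_def using s_split s_dec Co[OF R] Co_enum_surj by metis
  have tree': "splitting_tree s'"
    unfolding splitting_tree_def using s'_split s'_dec Co[OF R] Co_enum_surj by metis
  obtain f where f: "\<And>b x. x \<in> s b \<Longrightarrow> f x \<in> s' b"
    using splitting_tree_map[OF tree tree'] empty[OF R] by blast
  obtain g where g: "\<And>b y. y \<in> s' b \<Longrightarrow> g y \<in> s b"
    using splitting_tree_map[OF tree' tree] empty[OF R] by blast
  show ?thesis
  proof (rule exI[of _ f], rule exI[of _ g], intro conjI ballI allI impI)
    show "f x \<in> A'" "g (f x) = x" if "x \<in> A" for x
      using splitting_tree_separates[OF tree, of x "g (f x)"] f[of x "[]"] f g that nil by metis+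
    show "g y \<in> A" "f (g y) = y" if "y \<in> A'" for y
      using splitting_tree_separates[OF tree', of y "f (g y)"] g[of y "[]"] f g that nil by metis+
    show "openin W {x \<in> A. f x \<in> U}" if "openin W U" for U
      using splitting_tree_map_continuous[OF tree tree' f that] nil by simp
    show "openin W {y \<in> A'. g y \<in> U}" if "openin W U" for U
      using splitting_tree_map_continuous[OF tree' tree g that] nil by simp
  next
    fix x B assume x: "x \<in> A" and B: "B \<in> Co W"
    obtain n where n: "Co_enum n = B" using Co_enum_surj[OF B] by blast
    have "\<exists>b. length b = k \<and> x \<in> s b" for k
      using splitting_tree_branch[OF tree, of x] x nil(1) by metis
    then obtain b c where b: "length b = Suc (2 * n)" "x \<in> s b" and c: "length c = Suc (Suc (2 * n))" "x \<in> s c"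
      by meson
    show "\<exists>C C'. R C C' \<and> x \<in> C \<and> C \<subseteq> B \<and> f x \<in> C'" if "x \<in> B"
    proof -
      have "s b \<subseteq> B" using s_dec[OF b(1)] b(2) that n by blast
      then show ?thesis using R f b(2) by blast
    qed
    show "\<exists>C C'. R C C' \<and> x \<in> C \<and> f x \<in> C' \<and> C' \<subseteq> B" if "f x \<in> B"
    proof -
      have "s' c \<subseteq> B" using s'_dec[OF c(1)] f[OF c(2)] that n by blast
      then show ?thesis using R f c(2) by blast
    qed
  qed
qed

end

section \<open>Homogeneity of the points of a given ideal\<close>

context stone_trim_partition
begin

text \<open>Compact open sets with matching disjoint trim decompositions, relative to two marked points
  \<open>u\<close> and \<open>v\<close> that have to lie in corresponding pieces.\<close>

inductive matched :: "'w \<Rightarrow> 'w \<Rightarrow> 'w set \<Rightarrow> 'w set \<Rightarrow> bool" for u v where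
  matched_empty: "matched u v {} {}"
| matched_add: "\<lbrakk>matched u v A A'; C \<in> Trim W P X p; C' \<in> Trim W P X p; A \<inter> C = {}; A' \<inter> C' = {};
    u \<in> C \<longleftrightarrow> v \<in> C'\<rbrakk> \<Longrightarrow> matched u v (A \<union> C) (A' \<union> C')"

lemma matched_single:
  "C \<in> Trim W P X p \<Longrightarrow> C' \<in> Trim W P X p \<Longrightarrow> (u \<in> C \<longleftrightarrow> v \<in> C') \<Longrightarrow> matched u v C C'"
  using matched_add[OF matched_empty, of C p C'] by simp

lemma matched_Co: "matched u v A A' \<Longrightarrow> A \<in> Co W \<and> A' \<in> Co W"
  by (induction rule: matched.induct) (auto simp: empty_in_Co Co_Un Trim_Co)

lemma matched_type_set: "matched u v A A' \<Longrightarrow> type_set P X A = type_set P X A'"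
  by (induction rule: matched.induct) (auto simp: type_set_Un Trim_type)

lemma matched_marked: "matched u v A A' \<Longrightarrow> u \<in> A \<longleftrightarrow> v \<in> A'"
  by (induction rule: matched.induct) auto

lemma matched_sym: "matched u v A A' \<Longrightarrow> matched v u A' A"
  by (induction rule: matched.induct) (auto intro: matched.intros)

lemma type_set_empty_iff:
  assumes "openin W A"
  shows "type_set P X A = {} \<longleftrightarrow> A = {}"
proof
  assume *: "type_set P X A = {}"
  show "A = {}"
  proof (rule ccontr)
    assume "A \<noteq> {}"
    then obtain w where "w \<in> A" by blast
    then obtain p B where "B \<in> Trim W P X p" "B \<subseteq> A" using T1_base[OF assms] by metis
    then show False using * Trim_meets type_set_mono by blast
  qed
qed (simp add: type_set_def)

lemma matched_Un:
  assumes A: "matched u v A A'"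
  shows "matched u v B B' \<Longrightarrow> A \<inter> B = {} \<Longrightarrow> A' \<inter> B' = {} \<Longrightarrow> matched u v (A \<union> B) (A' \<union> B')"
proof (induction rule: matched.induct)
  case matched_empty
  then show ?case using A by simp
next
  case (matched_add B B' C p C')
  have "A \<inter> B = {}" "A' \<inter> B' = {}" "(A \<union> B) \<inter> C = {}" "(A' \<union> B') \<inter> C' = {}"
    using matched_add.prems matched_add.hyps(4,5) by blast+
  then have "matched u v ((A \<union> B) \<union> C) ((A' \<union> B') \<union> C')"
    using matched.matched_add[OF matched_add.IH matched_add.hyps(2,3)] matched_add.hyps(6) by blast
  then show ?case by (simp add: Un_assoc)
qed

text \<open>One step of copying: inside a \<open>p\<close>-trim set \<open>C'\<close> there is room for a copy of a piece \<open>E\<close> of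
  larger label, leaving a \<open>p\<close>-trim remainder. If \<open>u \<in> E\<close>, the copy has to be a neighbourhood of
  \<open>v\<close>, which is possible because the label of \<open>E\<close> is then in \<open>I\<^sub>u = I\<^sub>v\<close>; the remainder keeps a
  point \<open>y\<close> of \<open>X\<^sub>p\<close>.\<close>

lemma copy_piece:
  assumes I: "point_ideal W P X u = point_ideal W P X v"
    and C: "C \<in> Co W" "p \<in> type_set P X C" and pq: "(p, q) \<in> rel P"
    and E: "E \<in> Trim W P X q" and v: "u \<in> E \<Longrightarrow> v \<in> C"
  shows "\<exists>E'\<in>Trim W P X q. E' \<subseteq> C \<and> p \<in> type_set P X (C - E') \<and> (u \<in> E \<longleftrightarrow> v \<in> E')"
proof -
  have p: "p \<in> elems P" and q: "q \<in> elems P" using rel_elems[OF po pq] by auto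
  note meets = meets_above_outside_finite[OF Co_openin[OF C(1)] C(2)]
  show ?thesis
  proof (cases "u \<in> E")
    case True
    have qv: "q \<in> point_ideal W P X v" using True E I by (auto simp: mem_point_ideal)
    have "\<exists>y\<in>C \<inter> X p. y \<noteq> v"
    proof (cases "(p, p) \<in> rel P")
      case True
      then show ?thesis using meets[OF True, of "{v}"] by auto
    next
      case False
      obtain y where y: "y \<in> C" "y \<in> X p" using C(2) by (auto simp: mem_type_set)
      have "y \<noteq> v"
      proof
        assume "y = v"
        then have "point_ideal W P X v = po_down P p"
          using X_iff_point_ideal[OF p, of v] y X_topspace[OF p] by blast
        then have "po_le P q p" using qv by (simp add: mem_po_down)
        moreover have "po_le P p q" using pq p q by (simp add: po_le_def)
        ultimately show False using False pq po_le_antisym[OF po] by metis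
      qed
      then show ?thesis using y by blast
    qed
    then obtain y where y: "y \<in> C" "y \<in> X p" "y \<noteq> v" by blast
    have "openin W (C - {y})" using Co_openin[OF C(1)] by (simp add: openin_minus_finite)
    moreover have "v \<in> C - {y}" using v True y by blast
    moreover have "q \<in> type_set P X (C - {y})"
      using meets[OF pq, of "{y}"] q by (auto simp: mem_type_set)
    ultimately obtain E' where E': "E' \<in> Trim W P X q" "v \<in> E'" "E' \<subseteq> C - {y}"
      using trim_nbhd_of_label[OF qv] by blast
    have "p \<in> type_set P X (C - E')" using y E' p by (auto simp: mem_type_set)
    then show ?thesis using True E' by blast
  next
    case False
    obtain y where y: "y \<in> C" "y \<in> X p" using C(2) by (auto simp: mem_type_set)
    obtain z where z: "z \<in> C - {y, v}" "z \<in> X q" using meets[OF pq, of "{y, v}"] by auto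
    have "openin W (C - {y, v})" using Co_openin[OF C(1)] by (simp add: openin_minus_finite)
    then obtain E' where E': "E' \<in> Trim W P X q" "E' \<subseteq> C - {y, v}"
      using X_trim_nbhd[OF _ z q] by blast
    have "p \<in> type_set P X (C - E')" using y E' p by (auto simp: mem_type_set)
    then show ?thesis using False E' by blast
  qed
qed

text \<open>The pieces of \<open>D\<close> are copied one at a time. Their labels \<open>q\<close> satisfy \<open>p < q\<close>: the only case to
  exclude is \<open>q = p \<in> P\<^sup>d\<close>, where the single point of \<open>C \<inter> X\<^sub>p\<close> lies outside \<open>D\<close>.\<close>

lemma matched_split_off:
  assumes I: "point_ideal W P X u = point_ideal W P X v"
    and C: "C \<in> Trim W P X p" and C': "C' \<in> Trim W P X p" and uv: "u \<in> C \<longleftrightarrow> v \<in> C'"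
    and D: "D \<in> Co W" "D \<subseteq> C" and rest: "p \<in> type_set P X (C - D)"
  shows "\<exists>D'\<subseteq>C'. matched u v D D' \<and> matched u v (C - D) (C' - D')"
proof -
  obtain F where F: "finite F" "disjoint F" "\<And>E. E \<in> F \<Longrightarrow> \<exists>q. E \<in> Trim W P X q" "\<Union>F = D"
    using finite_disjoint_trim_decomposition[OF D(1)] by metis
  have label: "(p, q) \<in> rel P" if EF: "E \<in> F" and Eq: "E \<in> Trim W P X q" for E q
  proof (cases "p = q")
    case True
    show ?thesis
    proof (rule ccontr)
      assume "(p, q) \<notin> rel P"
      then have "p \<in> po_d P" using True Trim_elems[OF C] by (simp add: po_d_def)
      then obtain x where x: "C \<inter> X p = {x}" using Trim_card[OF C] card_1_singletonE by metis
      obtain y where "y \<in> E" "y \<in> X p" using Trim_meets[OF Eq] True by (auto simp: mem_type_set)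
      moreover obtain z where "z \<in> C - D" "z \<in> X p" using rest by (auto simp: mem_type_set)
      moreover have "E \<subseteq> D" using EF F(4) by blast
      ultimately show False using x D(2) by (metis Diff_iff IntI singletonD subsetD)
    qed
  next
    case False
    have "E \<subseteq> C" using EF F(4) D(2) by blast
    then have "po_le P p q" using Trim_type_mono[OF C Eq] by blast
    then show ?thesis using False by (simp add: po_le_def)
  qed
  have "\<exists>D'\<subseteq>C'. matched u v (\<Union>G) D' \<and> p \<in> type_set P X (C' - D')" if "G \<subseteq> F" for G
    using finite_subset[OF that F(1)] that
  proof (induction G rule: finite_induct)
    case empty
    then show ?case using matched_empty Trim_meets[OF C'] by (intro exI[of _ "{}"]) simp
  next
    case (insert E G)
    then have "G \<subseteq> F" by simp
    from insert.IH[OF this] obtain D' where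
      D': "D' \<subseteq> C'" "matched u v (\<Union>G) D'" "p \<in> type_set P X (C' - D')" by blast
    have E: "E \<in> F" using insert.prems by blast
    then obtain q where q: "E \<in> Trim W P X q" using F(3) by blast
    have "disjnt E B" if "B \<in> G" for B
      using pairwiseD[OF F(2) E, of B] that insert by blast
    then have disj: "\<Union>G \<inter> E = {}" by (auto simp: disjnt_def)
    have v: "v \<in> C' - D'" if "u \<in> E"
    proof -
      have "u \<in> C" using that E F(4) D(2) by blast
      moreover have "u \<notin> \<Union>G" using that disj by blast
      ultimately show ?thesis using uv matched_marked[OF D'(2)] by blast
    qed
    have "C' - D' \<in> Co W" using Trim_Co[OF C'] matched_Co[OF D'(2)] by (simp add: Co_Diff)
    then obtain E' where E': "E' \<in> Trim W P X q" "E' \<subseteq> C' - D'" "p \<in> type_set P X (C' - D' - E')"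
      "u \<in> E \<longleftrightarrow> v \<in> E'"
      using copy_piece[OF I _ D'(3) label[OF E q] q v] by metis
    have "matched u v (\<Union>G \<union> E) (D' \<union> E')"
      using D'(2) q E' disj by (intro matched_add) auto
    moreover have "\<Union>(insert E G) = \<Union>G \<union> E" "C' - (D' \<union> E') = C' - D' - E'" by blast+
    ultimately show ?case using D'(1) E'(2,3) by (intro exI[of _ "D' \<union> E'"]) auto
  qed
  from this[OF order_refl] obtain D' where D': "D' \<subseteq> C'" "matched u v D D'" "p \<in> type_set P X (C' - D')"
    using F(4) by auto
  have "C - D \<in> Trim W P X p"
    using Trim_subset[OF C _ _ rest] Co_Diff[OF Trim_Co[OF C] D(1)] by blast
  moreover have "C' - D' \<in> Trim W P X p"
    using Trim_subset[OF C' _ _ D'(3)] Co_Diff[OF Trim_Co[OF C']] matched_Co[OF D'(2)] by blast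
  moreover have "u \<in> C - D \<longleftrightarrow> v \<in> C' - D'" using uv matched_marked[OF D'(2)] by blast
  ultimately have "matched u v (C - D) (C' - D')" by (rule matched_single)
  then show ?thesis using D' by blast
qed

text \<open>One of \<open>C \<inter> B\<close> and \<open>C - B\<close> meets \<open>X\<^sub>p\<close>; the other one is split off.\<close>

lemma matched_split_trim:
  assumes I: "point_ideal W P X u = point_ideal W P X v"
    and C: "C \<in> Trim W P X p" and C': "C' \<in> Trim W P X p" and uv: "u \<in> C \<longleftrightarrow> v \<in> C'" and B: "B \<in> Co W"
  shows "\<exists>D'\<subseteq>C'. matched u v (C \<inter> B) D' \<and> matched u v (C - B) (C' - D')"
proof (cases "p \<in> type_set P X (C - B)")
  case True
  then show ?thesis
    using matched_split_off[OF I C C' uv, of "C \<inter> B"] Co_Int[OF Trim_Co[OF C] B] by (simp add: Diff_Int)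
next
  case False
  then have "p \<in> type_set P X (C - (C - B))"
    using Trim_meets[OF C] by (auto simp: mem_type_set)
  then obtain D' where D': "D' \<subseteq> C'" "matched u v (C - B) D'" "matched u v (C - (C - B)) (C' - D')"
    using matched_split_off[OF I C C' uv Co_Diff[OF Trim_Co[OF C] B] Diff_subset] by blast
  moreover have "C - (C - B) = C \<inter> B" "C' - (C' - D') = D'" using D'(1) by blast+
  ultimately show ?thesis by (intro exI[of _ "C' - D'"]) simp
qed

lemma matched_split:
  assumes I: "point_ideal W P X u = point_ideal W P X v" and B: "B \<in> Co W"
  shows "matched u v A A' \<Longrightarrow> \<exists>D'\<subseteq>A'. matched u v (A \<inter> B) D' \<and> matched u v (A - B) (A' - D')"
proof (induction rule: matched.induct)
  case matched_empty
  then show ?case using matched.matched_empty by simp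
next
  case (matched_add A A' C p C')
  from matched_add.IH obtain D' where
    D': "D' \<subseteq> A'" "matched u v (A \<inter> B) D'" "matched u v (A - B) (A' - D')" by blast
  obtain E' where
    E': "E' \<subseteq> C'" "matched u v (C \<inter> B) E'" "matched u v (C - B) (C' - E')"
    using matched_split_trim[OF I matched_add.hyps(2,3,6) B] by blast
  have "matched u v ((A \<inter> B) \<union> (C \<inter> B)) (D' \<union> E')"
    using matched_add.hyps(4,5) D' E' by (intro matched_Un) blast+
  moreover have "matched u v ((A - B) \<union> (C - B)) ((A' - D') \<union> (C' - E'))"
    using matched_add.hyps(4,5) D' E' by (intro matched_Un) blast+
  moreover have "(A \<inter> B) \<union> (C \<inter> B) = (A \<union> C) \<inter> B" "(A - B) \<union> (C - B) = (A \<union> C) - B"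
    "(A' - D') \<union> (C' - E') = (A' \<union> C') - (D' \<union> E')"
    using matched_add.hyps(5) D'(1) E'(1) by blast+
  ultimately show ?case using D'(1) E'(1) by (intro exI[of _ "D' \<union> E'"]) auto
qed

text \<open>The ideal of a point depends only on the types of its small neighbourhoods.\<close>

lemma point_ideal_subset_of_matched_nbhds:
  assumes "\<And>B. B \<in> Co W \<Longrightarrow> x \<in> B \<Longrightarrow>
      \<exists>C C'. openin W C' \<and> type_set P X C' = type_set P X C \<and> C \<subseteq> B \<and> y \<in> C'"
  shows "point_ideal W P X x \<subseteq> point_ideal W P X y"
proof
  fix q assume "q \<in> point_ideal W P X x"
  then obtain D where D: "D \<in> Trim W P X q" "x \<in> D" by (auto simp: mem_point_ideal)
  then obtain C C' where C: "openin W C'" "type_set P X C' = type_set P X C" "C \<subseteq> D" "y \<in> C'"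
    using assms Trim_Co by metis
  obtain r E where r: "r \<in> point_ideal W P X y" and E: "E \<in> Trim W P X r" "E \<subseteq> C'"
    using T1_base[OF C(1,4)] by blast
  have "r \<in> type_set P X D"
    using Trim_meets[OF E(1)] type_set_mono[OF E(2)] type_set_mono[OF C(3)] C(2) by blast
  then show "q \<in> point_ideal W P X y" using Trim_type[OF D(1)] point_ideal_lower[OF r] by blast
qed

text \<open>Back and forth along \<open>matched\<close> gives a homeomorphism between disjoint neighbourhoods of \<open>u\<close>
  and \<open>v\<close>; exchanging the two neighbourhoods extends it to the whole space.\<close>

theorem homogeneous:
  assumes u: "u \<in> topspace W" and v: "v \<in> topspace W" and I: "point_ideal W P X u = point_ideal W P X v"
  shows "\<exists>h. PO_homeomorphism W P X h \<and> h u = v"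
proof (cases "u = v")
  case True
  then show ?thesis using homeomorphic_map_id by (intro exI[of _ id]) (auto simp: PO_homeomorphism_def)
next
  case False
  then obtain U V where UV: "openin W U" "openin W V" "u \<in> U" "v \<in> V" "disjnt U V"
    using hausdorff u v unfolding Hausdorff_space_def by metis
  obtain p1 A1 where A1: "p1 \<in> point_ideal W P X u" "A1 \<in> Trim W P X p1" "u \<in> A1" "A1 \<subseteq> U"
    using T1_base[OF UV(1,3)] by blast
  obtain p2 A2 where A2: "p2 \<in> point_ideal W P X v" "A2 \<in> Trim W P X p2" "v \<in> A2" "A2 \<subseteq> V"
    using T1_base[OF UV(2,4)] by blast
  obtain p where p: "p \<in> point_ideal W P X u" "po_le P p1 p" "po_le P p2 p"
    using po_ideal_directed[OF po_ideal_point_ideal[OF u] A1(1)] A2(1) I by metis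
  have "p \<in> type_set P X A1" using Trim_type[OF A1(2)] p(2) by simp
  then obtain A where A: "A \<in> Trim W P X p" "u \<in> A" "A \<subseteq> A1"
    using trim_nbhd_of_label[OF p(1) Trim_openin[OF A1(2)] A1(3)] by blast
  have pv: "p \<in> point_ideal W P X v" using p(1) I by simp
  have "p \<in> type_set P X A2" using Trim_type[OF A2(2)] p(3) by simp
  then obtain A' where A': "A' \<in> Trim W P X p" "v \<in> A'" "A' \<subseteq> A2"
    using trim_nbhd_of_label[OF pv Trim_openin[OF A2(2)] A2(3)] by blast
  have disj: "A \<inter> A' = {}" using A(3) A'(3) A1(4) A2(4) UV(5) unfolding disjnt_def by blast
  have m: "matched u v A A'" using A A' by (intro matched_single) auto
  have empty: "B = {} \<longleftrightarrow> B' = {}" if "matched u v B B'" for B B'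
    using matched_type_set[OF that] matched_Co[OF that] type_set_empty_iff Co_openin by metis
  have forward: "\<exists>D'\<subseteq>B'. matched u v (B \<inter> E) D' \<and> matched u v (B - E) (B' - D')"
    if "matched u v B B'" and "E \<in> Co W" for B B' E
    using matched_split[OF I that(2,1)] .
  have backward: "\<exists>D\<subseteq>B. matched u v D (B' \<inter> E) \<and> matched u v (B - D) (B' - E)"
    if BB': "matched u v B B'" and E: "E \<in> Co W" for B B' E
    using matched_split[OF I[symmetric] E matched_sym[OF BB']] matched_sym by metis
  have "\<exists>f g. (\<forall>x\<in>A. f x \<in> A' \<and> g (f x) = x) \<and> (\<forall>y\<in>A'. g y \<in> A \<and> f (g y) = y) \<and>
    (\<forall>U. openin W U \<longrightarrow> openin W {x \<in> A. f x \<in> U}) \<and>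
    (\<forall>U. openin W U \<longrightarrow> openin W {y \<in> A'. g y \<in> U}) \<and>
    (\<forall>x\<in>A. \<forall>B\<in>Co W. (x \<in> B \<longrightarrow> (\<exists>C C'. matched u v C C' \<and> x \<in> C \<and> C \<subseteq> B \<and> f x \<in> C')) \<and>
      (f x \<in> B \<longrightarrow> (\<exists>C C'. matched u v C C' \<and> x \<in> C \<and> f x \<in> C' \<and> C' \<subseteq> B)))" (is "\<exists>f g. ?P f g")
    by (rule back_and_forth[where R = "matched u v"])
      (fact matched_Co empty m forward backward)+
  then obtain f g where fg: "?P f g" by (elim exE) (rule that)
  note f = bspec[OF fg[THEN conjunct1]]
    and g = bspec[OF fg[THEN conjunct2, THEN conjunct1]]
    and cont = spec[OF fg[THEN conjunct2, THEN conjunct2, THEN conjunct1], THEN mp]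
      spec[OF fg[THEN conjunct2, THEN conjunct2, THEN conjunct2, THEN conjunct1], THEN mp]
  have nbhds: "\<forall>x\<in>A. \<forall>B\<in>Co W.
      (x \<in> B \<longrightarrow> (\<exists>C C'. matched u v C C' \<and> x \<in> C \<and> C \<subseteq> B \<and> f x \<in> C')) \<and>
      (f x \<in> B \<longrightarrow> (\<exists>C C'. matched u v C C' \<and> x \<in> C \<and> f x \<in> C' \<and> C' \<subseteq> B))"
    using fg by (elim conjE)
  note left = bspec[OF bspec[OF nbhds], THEN conjunct1, THEN mp]
    and right = bspec[OF bspec[OF nbhds], THEN conjunct2, THEN mp]
  have If: "point_ideal W P X (f x) = point_ideal W P X x" if x: "x \<in> A" for x
  proof
    show "point_ideal W P X x \<subseteq> point_ideal W P X (f x)"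
    proof (rule point_ideal_subset_of_matched_nbhds)
      fix B assume "B \<in> Co W" "x \<in> B"
      then obtain C C' where "matched u v C C'" "C \<subseteq> B" "f x \<in> C'" using left[OF x] by metis
      then show "\<exists>C C'. openin W C' \<and> type_set P X C' = type_set P X C \<and> C \<subseteq> B \<and> f x \<in> C'"
        using matched_Co matched_type_set Co_openin by metis
    qed
    show "point_ideal W P X (f x) \<subseteq> point_ideal W P X x"
    proof (rule point_ideal_subset_of_matched_nbhds)
      fix B assume "B \<in> Co W" "f x \<in> B"
      then obtain C C' where "matched u v C C'" "x \<in> C" "C' \<subseteq> B" using right[OF x] by metis
      then show "\<exists>C C'. openin W C' \<and> type_set P X C' = type_set P X C \<and> C \<subseteq> B \<and> x \<in> C'"
        using matched_Co matched_type_set Co_openin by metis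
    qed
  qed
  have fu: "f u = v"
  proof (rule ccontr)
    assume "f u \<noteq> v"
    have "openin W (A' - {v})" using Trim_openin[OF A'(1)] by (simp add: openin_minus_finite)
    then obtain B where B: "B \<in> Co W" "f u \<in> B" "B \<subseteq> A' - {v}"
      using Co_base f[OF A(2)] \<open>f u \<noteq> v\<close> by blast
    then obtain C C' where "matched u v C C'" "u \<in> C" "C' \<subseteq> B" using right[OF A(2)] by metis
    then show False using matched_marked B(3) by blast
  qed
  define h where "h x = (if x \<in> A then f x else if x \<in> A' then g x else x)" for x
  have topA: "A \<subseteq> topspace W" "A' \<subseteq> topspace W"
    using A(1) A'(1) Trim_Co Co_subset_topspace by blast+
  have hh: "h (h x) = x" for x using f g disj by (auto simp: h_def)
  have htop: "h x \<in> topspace W" if "x \<in> topspace W" for x using that f g topA by (auto simp: h_def)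
  have Ih: "point_ideal W P X (h x) = point_ideal W P X x" for x
    using If g by (auto simp: h_def) metis+
  have "continuous_map W W h"
    unfolding continuous_map_def
  proof (intro conjI allI impI)
    show "h \<in> topspace W \<rightarrow> topspace W" using htop by blast
    fix U assume U: "openin W U"
    have "openin W (U - A - A')"
      using U A(1) A'(1) Trim_Co Co_closedin openin_diff by blast
    moreover have "{x \<in> topspace W. h x \<in> U} = {x \<in> A. f x \<in> U} \<union> {x \<in> A'. g x \<in> U} \<union> (U - A - A')"
      using topA disj openin_subset[OF U] by (auto simp: h_def)
    ultimately show "openin W {x \<in> topspace W. h x \<in> U}"
      using cont[OF U] by (simp add: openin_Un)
  qed
  then have "homeomorphic_maps W W h h" using hh by (simp add: homeomorphic_maps_def)
  then have "homeomorphic_map W W h" by (rule homeomorphic_maps_imp_map)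
  moreover have "h ` X q = X q" if q: "q \<in> elems P" for q
  proof -
    have "h x \<in> X q" if "x \<in> X q" for x
      using X_iff_point_ideal[OF q] that X_topspace[OF q] htop Ih by (metis subsetD)
    then show ?thesis using hh by (metis image_iff subsetI subset_antisym image_subsetI)
  qed
  moreover have "h u = v" using fu A(2) by (simp add: h_def)
  ultimately show ?thesis by (auto simp: PO_homeomorphism_def)
qed

text \<open>A homeomorphism that maps each \<open>X\<^sub>q\<close> onto itself maps trim sets to trim sets of the same
  label.\<close>

lemma PO_homeomorphism_point_ideal_subset:
  assumes h: "PO_homeomorphism W P X h" and w: "w \<in> topspace W"
  shows "point_ideal W P X w \<subseteq> point_ideal W P X (h w)"
proof
  have hom: "homeomorphic_map W W h" and hX: "\<And>q. q \<in> elems P \<Longrightarrow> h ` X q = X q"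
    using h by (auto simp: PO_homeomorphism_def)
  have inj: "inj_on h (topspace W)" using hom homeomorphic_eq_everything_map by blast
  fix p assume "p \<in> point_ideal W P X w"
  then obtain A where A: "A \<in> Trim W P X p" "w \<in> A" by (auto simp: mem_point_ideal)
  have topA: "A \<subseteq> topspace W" using Co_subset_topspace[OF Trim_Co[OF A(1)]] .
  have int: "h ` A \<inter> X q = h ` (A \<inter> X q)" if "q \<in> elems P" for q
    using inj_on_image_Int[OF inj topA X_topspace[OF that]] hX[OF that] by simp
  have "h ` A \<in> Co W"
    using Trim_Co[OF A(1)] homeomorphic_map_openness[OF hom topA] homeomorphic_map_compactness[OF hom topA]
    by (simp add: Co_def)
  moreover have "type_set P X (h ` A) = type_set P X A"
    unfolding type_set_def using int by (metis (no_types, lifting) image_is_empty)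
  moreover have "card (h ` A \<inter> X p) = card (A \<inter> X p)"
    unfolding int[OF Trim_elems[OF A(1)]] using inj topA by (intro card_image) (meson Int_lower1 inj_on_subset)
  ultimately have "h ` A \<in> Trim W P X p" using A(1) by (simp add: Trim_def)
  then show "p \<in> point_ideal W P X (h w)" using A(2) by (auto simp: mem_point_ideal)
qed

lemma PO_homeomorphism_point_ideal:
  assumes h: "PO_homeomorphism W P X h" and w: "w \<in> topspace W"
  shows "point_ideal W P X (h w) = point_ideal W P X w"
proof
  have "homeomorphic_map W W h" using h by (simp add: PO_homeomorphism_def)
  then obtain k where k: "homeomorphic_maps W W h k" using homeomorphic_map_maps by metis
  then have kh: "\<And>x. x \<in> topspace W \<Longrightarrow> k (h x) = x" by (simp add: homeomorphic_maps_def)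
  have "k ` X q = X q" if q: "q \<in> elems P" for q
  proof -
    have "k ` X q = k ` h ` X q" using h q by (simp add: PO_homeomorphism_def)
    also have "\<dots> = X q" using kh X_topspace[OF q] by (force simp: image_iff)
    finally show ?thesis .
  qed
  moreover have "homeomorphic_map W W k" using k homeomorphic_maps_sym homeomorphic_maps_imp_map by blast
  ultimately have "PO_homeomorphism W P X k" by (simp add: PO_homeomorphism_def)
  moreover have "h w \<in> topspace W" using k w by (auto simp: homeomorphic_maps_def continuous_map_def)
  ultimately show "point_ideal W P X (h w) \<subseteq> point_ideal W P X w"
    using PO_homeomorphism_point_ideal_subset[of k "h w"] kh[OF w] by simp
qed (rule PO_homeomorphism_point_ideal_subset[OF assms])

theorem id_partition_orbits: "idX ` elems idP = PO_homeo_orbits W P X"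
proof -
  have orbit: "{h w | h. PO_homeomorphism W P X h} = idX (point_ideal W P X w)" if w: "w \<in> topspace W" for w
  proof
    show "{h w | h. PO_homeomorphism W P X h} \<subseteq> idX (point_ideal W P X w)"
    proof
      fix y assume "y \<in> {h w | h. PO_homeomorphism W P X h}"
      then obtain h where h: "PO_homeomorphism W P X h" "y = h w" by blast
      then have "h ` topspace W = topspace W"
        by (simp add: PO_homeomorphism_def homeomorphic_imp_surjective_map)
      then have "y \<in> topspace W" using h w by blast
      then show "y \<in> idX (point_ideal W P X w)"
        using PO_homeomorphism_point_ideal[OF h(1) w] h(2) by (simp add: mem_idX)
    qed
    show "idX (point_ideal W P X w) \<subseteq> {h w | h. PO_homeomorphism W P X h}"
      using homogeneous[OF w] by (auto simp: mem_idX) metis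
  qed
  have "J \<in> point_ideal W P X ` topspace W" if "po_ideal P J" for J
    using id.X_nonempty[of J] that by (auto simp: mem_idX)
  then have "elems idP = point_ideal W P X ` topspace W" using po_ideal_point_ideal by auto
  then show ?thesis unfolding PO_homeo_orbits_def by (simp add: image_image orbit)
qed

end
section \<open>Complete semi-trim partitions with the same clean interior\<close>

context stone_trim_partition
begin

text \<open>Let \<open>V\<close> be a complete semi-trim partition with clean interior \<open>X\<close>. As \<open>X\<^sub>p\<close> is dense in \<open>V\<^sub>p\<close>,
  both have the same limit points, so \<open>P\<close> carries the order induced from \<open>Q\<close>, and the trim sets of
  the two partitions coincide. Each neighbourhood of a point \<open>w\<close> of \<open>V\<^sub>r\<close> contains a trim set with
  label in \<open>I\<^sub>w\<close>, and so meets \<open>V\<^sub>u\<close> for every upper bound \<open>u\<close> of \<open>I\<^sub>w\<close>; thus \<open>w\<close> is in \<open>V\<^sub>u\<close> or a limit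
  point of it, and \<open>r \<le> u\<close> either way.\<close>

context
  fixes Q :: "'p po_system" and V :: "'p \<Rightarrow> 'w set"
  assumes complete: "complete_partition W Q V" and semi: "semi_trim_partition W Q V"
    and interior: "clean_interior_eq W Q V (elems P) X"
begin

interpretation V: stone_T1_partition W Q V
  using semi by unfold_locales (auto simp: semi_trim_partition_def)

lemma labels_V: "trim_labels W Q V = elems P"
  using interior by (simp add: clean_interior_eq_def)

lemma elems_subset_Q: "p \<in> elems P \<Longrightarrow> p \<in> elems Q"
  using labels_V by (auto simp: trim_labels_def)

lemma X_subset_V: "p \<in> elems P \<Longrightarrow> X p \<subseteq> V p"
  using interior by (auto simp: clean_interior_eq_def clean_interior_def)

lemma X_dense_in_V: "p \<in> elems P \<Longrightarrow> V p \<subseteq> W closure_of X p"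
  using semi interior labels_V
  by (auto simp: semi_trim_partition_def ST3_cond_def clean_interior_eq_def)

lemma meets_V_imp_meets_X:
  assumes "p \<in> elems P" "openin W T" "y \<in> T" "y \<in> V p"
  shows "\<exists>z. z \<in> T \<and> z \<in> X p"
proof -
  have "y \<in> W closure_of X p" using X_dense_in_V assms by blast
  then show ?thesis using assms unfolding in_closure_of by blast
qed

lemma derived_V:
  assumes p: "p \<in> elems P"
  shows "W derived_set_of V p = W derived_set_of X p"
proof
  show "W derived_set_of X p \<subseteq> W derived_set_of V p" using X_subset_V[OF p] by (rule derived_set_of_mono)
  show "W derived_set_of V p \<subseteq> W derived_set_of X p"
  proof
    fix x assume x: "x \<in> W derived_set_of V p"
    have "\<exists>y. y \<noteq> x \<and> y \<in> X p \<and> y \<in> T" if T: "x \<in> T" "openin W T" for T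
    proof -
      obtain y where y: "y \<noteq> x" "y \<in> V p" "y \<in> T" using x T unfolding in_derived_set_of by metis
      have "openin W (T - {x})" using T by (simp add: openin_minus_finite)
      then show ?thesis using meets_V_imp_meets_X[OF p _ _ y(2)] y by blast
    qed
    then show "x \<in> W derived_set_of X p" using x unfolding in_derived_set_of by blast
  qed
qed

lemma rel_Q_iff:
  assumes p: "p \<in> elems P" and q: "q \<in> elems P"
  shows "(q, p) \<in> rel Q \<longleftrightarrow> (q, p) \<in> rel P"
proof -
  obtain y where y: "y \<in> X q" using X_nonempty[OF q] by blast
  then have "y \<in> V q" using X_subset_V[OF q] by blast
  then show ?thesis
    using derived_iff[OF p q y] V.derived_iff[OF elems_subset_Q[OF p] elems_subset_Q[OF q]] derived_V[OF p]
    by simp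
qed

lemma po_le_Q_iff: "p \<in> elems P \<Longrightarrow> q \<in> elems P \<Longrightarrow> po_le Q p q \<longleftrightarrow> po_le P p q"
  by (simp add: po_le_def rel_Q_iff elems_subset_Q)

lemma type_set_V_iff:
  assumes "openin W A" "p \<in> elems P"
  shows "p \<in> type_set Q V A \<longleftrightarrow> p \<in> type_set P X A"
  using meets_V_imp_meets_X[OF assms(2,1)] X_subset_V[OF assms(2)] assms(2) elems_subset_Q
  unfolding mem_type_set V.mem_type_set by blast

lemma Trim_V:
  assumes p: "p \<in> elems P"
  shows "Trim W Q V p = Trim W P X p"
proof
  have d: "p \<in> po_d Q \<longleftrightarrow> p \<in> po_d P" using p elems_subset_Q rel_Q_iff by (simp add: po_d_def)
  show "Trim W Q V p \<subseteq> Trim W P X p"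
  proof
    fix A assume A: "A \<in> Trim W Q V p"
    have op: "openin W A" using V.Trim_openin[OF A] .
    have pA: "p \<in> type_set P X A" using V.Trim_meets[OF A] type_set_V_iff[OF op p] by blast
    show "A \<in> Trim W P X p"
    proof (rule TrimI)
      show "A \<in> Co W" using V.Trim_Co[OF A] .
      show "p \<in> type_set P X A" by fact
      show "po_le P p q" if q: "q \<in> type_set P X A" for q
      proof -
        have qe: "q \<in> elems P" using q by (simp add: mem_type_set)
        then have "q \<in> type_set Q V A" using q type_set_V_iff[OF op] by blast
        then have "po_le Q p q" using V.Trim_type[OF A] by blast
        then show ?thesis using po_le_Q_iff[OF p qe] by blast
      qed
      assume "p \<in> po_d P"
      then obtain x where "A \<inter> V p = {x}" using d V.Trim_card[OF A] card_1_singletonE by metis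
      moreover have "A \<inter> X p \<noteq> {}" using pA by (auto simp: mem_type_set)
      moreover have "A \<inter> X p \<subseteq> A \<inter> V p" using X_subset_V[OF p] by blast
      ultimately have "A \<inter> X p = {x}" by (simp add: subset_singleton_iff)
      then show "card (A \<inter> X p) = 1" by simp
    qed
  qed
  show "Trim W P X p \<subseteq> Trim W Q V p"
  proof
    fix A assume A: "A \<in> Trim W P X p"
    have op: "openin W A" using Trim_openin[OF A] .
    show "A \<in> Trim W Q V p"
    proof (rule V.TrimI)
      show "A \<in> Co W" using Trim_Co[OF A] .
      show "p \<in> type_set Q V A" using Trim_meets[OF A] type_set_V_iff[OF op p] by blast
      \<comment> \<open>A point of \<open>V\<^sub>r\<close> in \<open>A\<close> has a trim neighbourhood in \<open>A\<close>, whose label \<open>s \<le> r\<close> is in \<open>P\<close>.\<close>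
      show "po_le Q p r" if r: "r \<in> type_set Q V A" for r
      proof -
        obtain x where x: "x \<in> A" "x \<in> V r" "r \<in> elems Q" using r by (auto simp: V.mem_type_set)
        obtain s C where C: "C \<in> Trim W Q V s" "x \<in> C" "C \<subseteq> A" using V.T1_base[OF op x(1)] by blast
        have "r \<in> type_set Q V C" using C(2) x by (auto simp: V.mem_type_set)
        then have sr: "po_le Q s r" using V.Trim_type[OF C(1)] by blast
        have s: "s \<in> elems P"
          using C(1) labels_V V.Trim_elems[OF C(1)] by (auto simp: trim_labels_def)
        have "s \<in> type_set Q V A" using V.Trim_meets[OF C(1)] V.type_set_mono[OF C(3)] by blast
        then have "po_le P p s" using type_set_V_iff[OF op s] Trim_type[OF A] by blast
        then show ?thesis using po_le_Q_iff[OF p s] sr po_le_trans[OF V.po] by blast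
      qed
      assume "p \<in> po_d Q"
      then have nrel: "(p, p) \<notin> rel Q" by (simp add: po_d_def)
      \<comment> \<open>\<open>X\<^sub>p\<close> is dense in \<open>V\<^sub>p\<close>, which contains none of its limit points, so \<open>X\<^sub>p\<close> is all of \<open>V\<^sub>p\<close>.\<close>
      have "V p \<subseteq> X p"
      proof
        fix y assume y: "y \<in> V p"
        then have "y \<notin> W derived_set_of X p"
          using V.derived_iff[OF elems_subset_Q[OF p] elems_subset_Q[OF p] y] nrel derived_V[OF p] by blast
        moreover have "y \<in> W closure_of X p" using y X_dense_in_V[OF p] by blast
        ultimately show "y \<in> X p" by (simp add: closure_of)
      qed
      then have "A \<inter> V p = A \<inter> X p" using X_subset_V[OF p] by blast
      then show "card (A \<inter> V p) = 1" using Trim_card[OF A] d \<open>p \<in> po_d Q\<close> by simp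
    qed
  qed
qed

lemma label_V_is_sup:
  assumes w: "w \<in> V r" and r: "r \<in> elems Q"
  shows "is_po_sup Q (point_ideal W P X w) r"
  unfolding is_po_sup_def
proof (intro conjI ballI impI)
  show "r \<in> elems Q" by fact
  have wW: "w \<in> topspace W" using V.X_topspace[OF r] w by blast
  show "po_le Q p r" if "p \<in> point_ideal W P X w" for p
  proof -
    obtain A where A: "A \<in> Trim W P X p" "w \<in> A" using \<open>p \<in> point_ideal W P X w\<close> by (auto simp: mem_point_ideal)
    then have "A \<in> Trim W Q V p" using Trim_V Trim_elems by blast
    moreover have "r \<in> type_set Q V A" using A(2) w r by (auto simp: V.mem_type_set)
    ultimately show ?thesis using V.Trim_type by blast
  qed
  fix u assume u: "u \<in> elems Q" and ub: "\<forall>p\<in>point_ideal W P X w. po_le Q p u"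
  show "po_le Q r u"
  proof (cases "w \<in> V u")
    case True
    then show ?thesis using V.X_unique[OF r u w] u by (simp add: po_le_refl)
  next
    case False
    have "\<exists>y. y \<noteq> w \<and> y \<in> V u \<and> y \<in> T" if T: "w \<in> T" "openin W T" for T
    proof -
      obtain p A where p: "p \<in> point_ideal W P X w" and A: "A \<in> Trim W P X p" "A \<subseteq> T"
        using T1_base[OF T(2,1)] by blast
      have "A \<in> Trim W Q V p" using A(1) Trim_V Trim_elems by blast
      then have "u \<in> type_set Q V A" using ub p V.Trim_type by blast
      then obtain y where "y \<in> A" "y \<in> V u" by (auto simp: V.mem_type_set)
      then show ?thesis using A(2) False by (metis subsetD)
    qed
    then have "w \<in> W derived_set_of V u" using wW unfolding in_derived_set_of by blast
    then have "(r, u) \<in> rel Q" using V.derived_iff[OF u r w] by blast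
    then show ?thesis using r u by (simp add: po_le_def)
  qed
qed

lemma id_partition_refines_complete_partition:
  "\<exists>\<beta>. (\<forall>J\<in>elems idP. is_po_sup Q J (\<beta> J)) \<and> regularly_refines W idP idX \<beta> Q V"
proof -
  define \<beta> where "\<beta> J = (SOME r. is_po_sup Q J r)" for J
  have point: "is_po_sup Q (point_ideal W P X w) r \<and> \<beta> (point_ideal W P X w) = r"
    if "w \<in> V r" "r \<in> elems Q" for w r
  proof -
    have sup: "is_po_sup Q (point_ideal W P X w) r" using label_V_is_sup[OF that] .
    then have "is_po_sup Q (point_ideal W P X w) (\<beta> (point_ideal W P X w))"
      unfolding \<beta>_def by (rule someI)
    then show ?thesis using sup is_po_sup_unique[OF V.po] by blast
  qed
  have cover: "\<exists>r\<in>elems Q. w \<in> V r" if "w \<in> topspace W" for w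
    using that complete by (auto simp: complete_partition_def union_of_family_def)
  have sub: "idX J \<subseteq> V (\<beta> J)" for J
  proof
    fix w assume "w \<in> idX J"
    then have w: "w \<in> topspace W" "point_ideal W P X w = J" by (auto simp: mem_idX)
    obtain r where r: "r \<in> elems Q" "w \<in> V r" using cover[OF w(1)] by blast
    then have "\<beta> J = r" using point[OF r(2,1)] w(2) by simp
    then show "w \<in> V (\<beta> J)" using r(2) by simp
  qed
  have sup: "is_po_sup Q J (\<beta> J)" if J: "J \<in> elems idP" for J
  proof -
    obtain w where "w \<in> idX J" using id.X_nonempty[OF J] by blast
    then have w: "w \<in> topspace W" "point_ideal W P X w = J" by (auto simp: mem_idX)
    obtain r where r: "r \<in> elems Q" "w \<in> V r" using cover[OF w(1)] by blast
    then show ?thesis using point[OF r(2,1)] w(2) by simp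
  qed
  have "p \<in> \<beta> ` type_set idP idX A" if p: "p \<in> trim_labels W Q V" and A: "A \<in> Trim W Q V p" for p A
  proof -
    have pe: "p \<in> elems P" using p labels_V by simp
    then have A': "A \<in> Trim W P X p" using A Trim_V by simp
    obtain y where y: "y \<in> X p" using X_nonempty[OF pe] by blast
    then have "point_ideal W P X y = po_down P p" using X_iff_point_ideal[OF pe] X_topspace[OF pe] by blast
    moreover have "y \<in> V p" using y X_subset_V[OF pe] by blast
    ultimately have "\<beta> (po_down P p) = p" using point[OF _ elems_subset_Q[OF pe]] by metis
    moreover have "po_down P p \<in> type_set idP idX A" using id.Trim_meets[OF Trim_imp_id_Trim[OF A']] .
    ultimately show ?thesis by (metis imageI)
  qed
  moreover have "\<beta> \<in> elems idP \<rightarrow> elems Q" using sup by (auto simp: is_po_sup_def)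
  ultimately have "regularly_refines W idP idX \<beta> Q V"
    unfolding regularly_refines_def using V.partition V.T1 PO_partition_id T1_id sub by blast
  then show ?thesis using sup by blast
qed

end

section \<open>Refinements\<close>

text \<open>If \<open>V\<close> refines \<open>X\<close> along \<open>\<alpha>\<close>, then the ideal of a point with respect to \<open>X\<close> is generated by the
  image of its ideal with respect to \<open>V\<close>: small trim sets of either partition around the point lie
  in given trim sets of the other, and their labels are compared by \<open>\<alpha>\<close>.\<close>

context
  fixes Q :: "'q po_system" and V :: "'q \<Rightarrow> 'w set" and \<alpha> :: "'q \<Rightarrow> 'p"
  assumes V_trim: "trim_partition W Q V" and morphism: "po_morphism Q P \<alpha>"
    and refines: "regularly_refines W Q V \<alpha> P X"
begin

interpretation V: stone_trim_partition W Q V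
  using V_trim by unfold_locales

lemma point_ideal_of_refinement:
  "point_ideal W P X w = {p. \<exists>q\<in>point_ideal W Q V w. po_le P p (\<alpha> q)}"
proof
  have \<alpha>: "\<alpha> q \<in> elems P" "V q \<subseteq> X (\<alpha> q)" if "q \<in> elems Q" for q
    using refines that by (auto simp: regularly_refines_def)
  have mono: "po_le P (\<alpha> q) (\<alpha> r)" if "po_le Q q r" for q r
  proof (cases "q = r")
    case False
    then have qr: "q \<in> elems Q" "r \<in> elems Q" "(q, r) \<in> rel Q" using that by (auto simp: po_le_def)
    then have "\<alpha> r \<in> \<alpha> ` {r \<in> elems Q. (q, r) \<in> rel Q}" by blast
    then have "(\<alpha> q, \<alpha> r) \<in> rel P" using morphism qr(1) by (auto simp: po_morphism_def)
    then show ?thesis using \<alpha> qr by (simp add: po_le_def)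
  qed (use \<alpha> that in \<open>auto simp: po_le_def\<close>)
  show "{p. \<exists>q\<in>point_ideal W Q V w. po_le P p (\<alpha> q)} \<subseteq> point_ideal W P X w"
  proof clarify
    fix p q assume "q \<in> point_ideal W Q V w" and pq: "po_le P p (\<alpha> q)"
    then obtain A where A: "A \<in> Trim W Q V q" "w \<in> A" by (auto simp: V.mem_point_ideal)
    obtain r C where r: "r \<in> point_ideal W P X w" and C: "C \<in> Trim W P X r" "C \<subseteq> A"
      using T1_base[OF V.Trim_openin[OF A(1)] A(2)] by blast
    have "r \<in> trim_labels W P X" using C(1) Trim_elems[OF C(1)] by (auto simp: trim_labels_def)
    then have "r \<in> \<alpha> ` type_set Q V C" using refines C(1) by (auto simp: regularly_refines_def)
    then obtain s where s: "s \<in> type_set Q V C" "r = \<alpha> s" by blast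
    then have "po_le Q q s" using V.type_set_mono[OF C(2)] V.Trim_type[OF A(1)] by blast
    then have "po_le P p r" using mono pq s(2) po_le_trans[OF po] by blast
    then show "p \<in> point_ideal W P X w" using point_ideal_lower[OF r] by blast
  qed
  show "point_ideal W P X w \<subseteq> {p. \<exists>q\<in>point_ideal W Q V w. po_le P p (\<alpha> q)}"
  proof
    fix p assume "p \<in> point_ideal W P X w"
    then obtain A where A: "A \<in> Trim W P X p" "w \<in> A" by (auto simp: mem_point_ideal)
    obtain q C where q: "q \<in> point_ideal W Q V w" and C: "C \<in> Trim W Q V q" "C \<subseteq> A"
      using V.T1_base[OF Trim_openin[OF A(1)] A(2)] by blast
    have qe: "q \<in> elems Q" using V.Trim_elems[OF C(1)] .
    obtain x where "x \<in> C" "x \<in> V q" using V.Trim_meets[OF C(1)] by (auto simp: V.mem_type_set)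
    then have "x \<in> A" "x \<in> X (\<alpha> q)" using C(2) \<alpha>(2)[OF qe] by blast+
    then have "\<alpha> q \<in> type_set P X A" using \<alpha>(1)[OF qe] by (auto simp: mem_type_set)
    then have "po_le P p (\<alpha> q)" using Trim_type[OF A(1)] by blast
    then show "p \<in> {p. \<exists>q\<in>point_ideal W Q V w. po_le P p (\<alpha> q)}" using q by blast
  qed
qed

lemma id_partition_refines:
  "\<exists>f. regularly_refines W (ideal_completion Q) (id_partition W Q V) f idP idX"
proof -
  define f where "f K = {p. \<exists>q\<in>K. po_le P p (\<alpha> q)}" for K
  have f: "point_ideal W P X w = f (point_ideal W Q V w)" for w
    unfolding f_def by (rule point_ideal_of_refinement)
  have sub: "id_partition W Q V K \<subseteq> idX (f K)" for K
    using f by (auto simp: mem_idX V.mem_idX)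
  have "f K \<in> elems idP" if K: "K \<in> elems (ideal_completion Q)" for K
  proof -
    obtain w where "w \<in> id_partition W Q V K" using V.id.X_nonempty[OF K] by blast
    then have "w \<in> topspace W" "point_ideal W Q V w = K" by (auto simp: V.mem_idX)
    then show ?thesis using po_ideal_point_ideal f by (metis elems_ideal_completion)
  qed
  moreover have "J \<in> f ` type_set (ideal_completion Q) (id_partition W Q V) A"
    if A: "A \<in> Trim W idP idX J" for A J
  proof -
    obtain p where p: "p \<in> elems P" "J = po_down P p" "A \<in> Trim W P X p" using id_Trim_imp_Trim[OF A] by blast
    then have "p \<in> trim_labels W P X" by (auto simp: trim_labels_def)
    then have "p \<in> \<alpha> ` type_set Q V A" using refines p(3) by (auto simp: regularly_refines_def)
    then obtain q x where q: "q \<in> elems Q" "p = \<alpha> q" and x: "x \<in> A" "x \<in> V q" by (auto simp: V.mem_type_set)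
    have xW: "x \<in> topspace W" using V.X_topspace[OF q(1)] x(2) by blast
    have "x \<in> X p" using x q refines by (auto simp: regularly_refines_def)
    then have "point_ideal W P X x = J" using X_iff_point_ideal[OF p(1) xW] p(2) by blast
    then have "f (point_ideal W Q V x) = J" using f by simp
    moreover have "point_ideal W Q V x \<in> type_set (ideal_completion Q) (id_partition W Q V) A"
      using x(1) xW V.po_ideal_point_ideal[OF xW] by (auto simp: V.id.mem_type_set V.mem_idX)
    ultimately show ?thesis by blast
  qed
  ultimately have "regularly_refines W (ideal_completion Q) (id_partition W Q V) f idP idX"
    unfolding regularly_refines_def using PO_partition_id T1_id V.PO_partition_id V.T1_id sub by blast
  then show ?thesis by blast
qed

end

end

theorem theorem4p21:
  fixes W :: "'w topology"
    and P :: "'p po_system"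
    and Y :: "'p \<Rightarrow> 'w set"
  assumes "omega_Stone_space W"
    and "primitive_space W"
    and "po_system P"
    and "trim_partition W P Y"
  shows "rank_partition W (ideal_completion P) (id_partition W P Y)
    \<and> clean_interior_eq W (ideal_completion P) (id_partition W P Y)
         (elems (principal_po P)) (as_principal P Y)
    \<and> regularly_extends W (ideal_completion P) (id_partition W P Y)
         (principal_po P) (as_principal P Y)
    \<and> id_partition W P Y ` elems (ideal_completion P) = PO_homeo_orbits W P Y
    \<and> (\<forall>(Q :: 'p po_system) V.
         complete_partition W Q V \<and> semi_trim_partition W Q V \<and>
         clean_interior_eq W Q V (elems P) Y \<longrightarrow>
         (\<exists>\<beta>. (\<forall>J\<in>elems (ideal_completion P). is_po_sup Q J (\<beta> J)) \<and>
              regularly_refines W (ideal_completion P) (id_partition W P Y) \<beta> Q V))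
    \<and> (\<forall>(Q :: 'q po_system) V \<alpha>.
         po_system Q \<and> trim_partition W Q V \<and>
         po_morphism Q P \<alpha> \<and> \<alpha> ` elems Q = elems P \<and>
         regularly_refines W Q V \<alpha> P Y \<longrightarrow>
         (\<exists>f. regularly_refines W (ideal_completion Q) (id_partition W Q V) f
                (ideal_completion P) (id_partition W P Y)))"
proof -
  interpret stone_trim_partition W P Y
    using assms(1,4) by unfold_locales
  show ?thesis
  proof (intro conjI allI impI)
    show "rank_partition W (ideal_completion P) (id_partition W P Y)" by (rule rank_partition_id)
    show "clean_interior_eq W (ideal_completion P) (id_partition W P Y)
        (elems (principal_po P)) (as_principal P Y)"
      by (rule clean_interior_eq_id)
    show "regularly_extends W (ideal_completion P) (id_partition W P Y)
        (principal_po P) (as_principal P Y)"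
      by (rule regularly_extends_id)
    show "id_partition W P Y ` elems (ideal_completion P) = PO_homeo_orbits W P Y"
      by (rule id_partition_orbits)
  next
    fix Q :: "'p po_system" and V
    assume "complete_partition W Q V \<and> semi_trim_partition W Q V \<and>
      clean_interior_eq W Q V (elems P) Y"
    then show "\<exists>\<beta>. (\<forall>J\<in>elems (ideal_completion P). is_po_sup Q J (\<beta> J)) \<and>
        regularly_refines W (ideal_completion P) (id_partition W P Y) \<beta> Q V"
      by (intro id_partition_refines_complete_partition) auto
  next
    fix Q :: "'q po_system" and V \<alpha>
    assume "po_system Q \<and> trim_partition W Q V \<and> po_morphism Q P \<alpha> \<and>
      \<alpha> ` elems Q = elems P \<and> regularly_refines W Q V \<alpha> P Y"
    then show "\<exists>f. regularly_refines W (ideal_completion Q) (id_partition W Q V) f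
        (ideal_completion P) (id_partition W P Y)"
      by (intro id_partition_refines[of Q V \<alpha>]) auto
  qed
qed

end
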